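(* $K_n'$ has convex antithickness at least $\sqrt{n/6}$ (which is unbounded). Consequently, convex antithickness is not bounded by geometric antithickness; that is, there is no function $g$ such that every graph $G$ has convex antithickness at most $g(a)$, where $a$ is the geometric antithickness of $G$. Thus convex antithickness and geometric antithickness are separated.
   Context: All graphs are undirected, finite and simple. $K_n$ is the complete graph on $n$ vertices, and $K_n'$ is the graph obtained from $K_n$ by subdividing each edge exactly once. A geometric drawing of a graph maps vertices to distinct points in the plane and edges to straight line segments between their end-vertices, such that no edge passes through a vertex other than its own end-vertices and edges cross properly. A geometric drawing is convex if every vertex is on the convex hull of the set of vertices. A set of edges in a drawing is a thrackle if every pair of distinct edges in it intersect exactly once (either at a common end-vertex or at a crossing point). The antithickness of a drawing is the minimum positive integer $k$ such that its edges can be partitioned into $k$ thrackles. The geometric (respectively, convex) antithickness of a graph $G$ is the minimum positive integer $k$ such that $G$ has a geometric (respectively, convex) drawing with antithickness $k$. Two graph parameters are separated if there is a class of graphs on which one of them is bounded and the other is unbounded. *)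

theory Defs
  imports "HOL-Analysis.Analysis"
begin

datatype 'a graph = Graph (verts: "'a set") (edges: "'a set set")

definition simple_graph :: "'a graph \<Rightarrow> bool" where
  "simple_graph G \<longleftrightarrow> finite (verts G) \<and> (\<forall>e\<in>edges G. e \<subseteq> verts G \<and> card e = 2)"

definition complete_graph :: "nat \<Rightarrow> nat graph" where
  "complete_graph n = Graph {..<n} {e. e \<subseteq> {..<n} \<and> card e = 2}"

(* Subdivides each edge e exactly once, with division vertex Inr e. *)
definition subdivision :: "'a graph \<Rightarrow> ('a + 'a set) graph" where
  "subdivision G = Graph (verts G <+> edges G) {{Inl v, Inr e} | v e. e \<in> edges G \<and> v \<in> e}"

type_synonym point = "real \<times> real"

(* For e = {v, w} this is closed_segment (p v) (p w), by segment_convex_hull. *)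
definition edge_segment :: "('a \<Rightarrow> point) \<Rightarrow> 'a set \<Rightarrow> point set" where
  "edge_segment p e = convex hull (p ` e)"

(* Two segments that meet in a single point, interior to both, are not collinear,
   so each passes at that point from one side of the other to the opposite side. *)
definition proper_crossing :: "('a \<Rightarrow> point) \<Rightarrow> 'a set \<Rightarrow> 'a set \<Rightarrow> point \<Rightarrow> bool" where
  "proper_crossing p e f x \<longleftrightarrow>
     edge_segment p e \<inter> edge_segment p f = {x} \<and> x \<notin> p ` e \<and> x \<notin> p ` f"

definition geometric_drawing :: "'a graph \<Rightarrow> ('a \<Rightarrow> point) \<Rightarrow> bool" where
  "geometric_drawing G p \<longleftrightarrow>
     inj_on p (verts G) \<and>
     (\<forall>e\<in>edges G. \<forall>v\<in>verts G - e. p v \<notin> edge_segment p e) \<and>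
     (\<forall>e\<in>edges G. \<forall>f\<in>edges G. e \<noteq> f \<longrightarrow>
        (\<forall>x\<in>edge_segment p e \<inter> edge_segment p f.
           x \<in> p ` (e \<inter> f) \<or> proper_crossing p e f x))"

(* A vertex is on the convex hull if it lies on the boundary of the hull;
   three collinear vertices on that boundary are allowed. *)
definition convex_drawing :: "'a graph \<Rightarrow> ('a \<Rightarrow> point) \<Rightarrow> bool" where
  "convex_drawing G p \<longleftrightarrow>
     geometric_drawing G p \<and> p ` verts G \<subseteq> frontier (convex hull (p ` verts G))"

definition thrackle :: "('a \<Rightarrow> point) \<Rightarrow> 'a set set \<Rightarrow> bool" where
  "thrackle p F \<longleftrightarrow>
     (\<forall>e\<in>F. \<forall>f\<in>F. e \<noteq> f \<longrightarrow>
        (\<exists>x. edge_segment p e \<inter> edge_segment p f = {x} \<and>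
             (x \<in> p ` (e \<inter> f) \<or> proper_crossing p e f x)))"

(* Partitions are given by colourings. Empty classes do not affect the minimum,
   except that they give an edgeless drawing antithickness 1. *)
definition drawing_antithickness :: "'a graph \<Rightarrow> ('a \<Rightarrow> point) \<Rightarrow> nat" where
  "drawing_antithickness G p =
     (LEAST k. 0 < k \<and> (\<exists>c :: 'a set \<Rightarrow> nat. c ` edges G \<subseteq> {..<k} \<and>
        (\<forall>i<k. thrackle p {e \<in> edges G. c e = i})))"

definition geometric_antithickness :: "'a graph \<Rightarrow> nat" where
  "geometric_antithickness G =
     (LEAST k. 0 < k \<and> (\<exists>p. geometric_drawing G p \<and> drawing_antithickness G p = k))"

definition convex_antithickness :: "'a graph \<Rightarrow> nat" where
  "convex_antithickness G =
     (LEAST k. 0 < k \<and> (\<exists>p. convex_drawing G p \<and> drawing_antithickness G p = k))"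

definition separated :: "('a graph \<Rightarrow> nat) \<Rightarrow> ('a graph \<Rightarrow> nat) \<Rightarrow> bool" where
  "separated \<alpha> \<beta> \<longleftrightarrow>
     (\<exists>C \<subseteq> Collect simple_graph.
        bdd_above (\<alpha> ` C) \<and> \<not> bdd_above (\<beta> ` C) \<or>
        bdd_above (\<beta> ` C) \<and> \<not> bdd_above (\<alpha> ` C))"

end

theory Submission
  imports Defs
begin

text \<open>
  In a convex drawing the vertices have a cyclic order; cut it open to a linear one. Two disjoint edges
  that cross then interleave: exactly one end of the second lies between the ends of the first. This
  is \<open>convex_drawing_vertex_order\<close>; its proof orders the vertices by their angle around an
  interior point of the convex hull and uses the supporting lines at the vertices, so that collinear
  vertices on the hull need no separate treatment.

  Suppose that the edges of such a drawing are partitioned into \<open>k\<close> thrackles, and consider paths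
  \<open>v x w\<close> of length two whose end pairs are nested, \<open>v\<^sub>0 < v\<^sub>1 < \<dots> < w\<^sub>1 < w\<^sub>0\<close>. If two of them agree
  in the colours of both edges, then corresponding edges cross, and this is only possible if
  exactly one of the two middle vertices lies between the ends of its path. Hence there are at most
  \<open>2 k\<^sup>2\<close> nested paths (\<open>nested_paths_bound\<close>). In the subdivided \<open>K\<^sub>n\<close> the original vertices are the ends
  of \<open>n div 2\<close> nested paths, so \<open>n \<le> 4 k\<^sup>2 + 1 \<le> 6 k\<^sup>2\<close>.

  For the separation it suffices to have graphs of bounded geometric but unbounded convex
  antithickness. The subdivisions of the complete bipartite graphs \<open>K\<^sub>m\<^sub>,\<^sub>m\<close> serve. They contain
  many nested paths in every vertex order (\<open>biclique_bound\<close>), so their convex antithickness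
  is unbounded. On the other hand they have a geometric drawing with two thrackles: the
  division vertices form a square grid, one side of the bipartition lies far below it and the other far
  to its left, both in the order opposite to the grid, so that the edges at one side are stars that
  cross each other (\<open>geometric_antithickness_biclique_subdivision\<close>).
\<close>

section \<open>Orientation of point triples\<close>

definition orient :: "point \<Rightarrow> point \<Rightarrow> point \<Rightarrow> real" where
  "orient a b c = (fst b - fst a) * (snd c - snd a) - (snd b - snd a) * (fst c - fst a)"

lemma orient_split: "orient a b c = orient q a b + orient q b c + orient q c a"
  by (simp add: orient_def algebra_simps)

lemma orient_swap: "orient a c b = - orient a b c" "orient b a c = - orient a b c"
  by (simp_all add: orient_def algebra_simps)

text \<open>Cramer's rule for the coordinates of \<open>c - q\<close> in the basis \<open>a - q\<close>, \<open>b - q\<close>, with the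
  determinant cleared and after applying the linear functional \<open>n\<close>.\<close>

lemma orient_barycentric:
  "orient q a b * (n \<bullet> (c - q)) = orient q c b * (n \<bullet> (a - q)) + orient q a c * (n \<bullet> (b - q))"
  by (cases n) (simp add: orient_def inner_prod_def algebra_simps)

section \<open>The cyclic order of points in convex position\<close>

text \<open>This is what remains of convexity: if \<open>q\<close> is interior to the convex hull of \<open>S\<close>, then a supporting
  line at a boundary point \<open>s\<close> has \<open>q\<close> strictly on its inner side.\<close>

definition supported_from :: "point \<Rightarrow> point set \<Rightarrow> bool" where
  "supported_from q S \<longleftrightarrow>
     (\<forall>s\<in>S. \<exists>n. 0 < n \<bullet> (s - q) \<and> (\<forall>t\<in>S. n \<bullet> (t - q) \<le> n \<bullet> (s - q)))"

text \<open>If \<open>c\<close> is seen from \<open>q\<close> between \<open>a\<close> and \<open>b\<close>, its coordinates in the basis \<open>a - q\<close>, \<open>b - q\<close> are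
  positive up to the determinant. As the functional supporting \<open>c\<close> is at most as large at \<open>a\<close> and
  \<open>b\<close> as at \<open>c\<close>, the coordinates must add up to at least the determinant.\<close>

lemma orient_in_sector:
  assumes S: "supported_from q S" "a \<in> S" "b \<in> S" "c \<in> S"
    and pos: "0 < orient q c b" "0 < orient q a c"
  shows "orient a b c \<le> 0"
proof -
  obtain n where K: "0 < n \<bullet> (c - q)"
    and n: "n \<bullet> (a - q) \<le> n \<bullet> (c - q)" "n \<bullet> (b - q) \<le> n \<bullet> (c - q)"
    using S by (auto simp: supported_from_def)
  have "orient q a b * (n \<bullet> (c - q)) \<le> (orient q c b + orient q a c) * (n \<bullet> (c - q))"
    unfolding orient_barycentric[of q a b n c] distrib_right
    using pos n by (intro add_mono mult_left_mono) auto
  then have "orient q a b \<le> orient q c b + orient q a c"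
    using K by simp
  then show ?thesis
    using orient_split[of a b c q] orient_swap[of q c b] orient_swap[of q c a] by linarith
qed

text \<open>If the coordinate of \<open>c\<close> along \<open>a - q\<close> is not positive, the functional supporting \<open>b\<close> bounds the sum
  of the coordinates from above; along \<open>b - q\<close>, the one supporting \<open>a\<close> does.\<close>

lemma orient_off_sector:
  assumes S: "supported_from q S" "a \<in> S" "b \<in> S" "c \<in> S"
    and pos: "0 < orient q a b" and off: "orient q c b \<le> 0 \<or> orient q a c \<le> 0"
  shows "0 \<le> orient a b c"
proof -
  have "orient q c b + orient q a c \<le> orient q a b"
  proof (cases "orient q c b \<le> 0")
    case True
    obtain n where K: "0 < n \<bullet> (b - q)"
      and n: "n \<bullet> (a - q) \<le> n \<bullet> (b - q)" "n \<bullet> (c - q) \<le> n \<bullet> (b - q)"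
      using S by (auto simp: supported_from_def)
    have "(orient q c b + orient q a c) * (n \<bullet> (b - q)) \<le> orient q a b * (n \<bullet> (c - q))"
      unfolding orient_barycentric[of q a b n c] distrib_right
      using mult_left_mono_neg[OF n(1) True] by simp
    also have "\<dots> \<le> orient q a b * (n \<bullet> (b - q))"
      using pos n by (intro mult_left_mono) auto
    finally show ?thesis using K by simp
  next
    case False
    with off have neg: "orient q a c \<le> 0" by simp
    obtain n where K: "0 < n \<bullet> (a - q)"
      and n: "n \<bullet> (b - q) \<le> n \<bullet> (a - q)" "n \<bullet> (c - q) \<le> n \<bullet> (a - q)"
      using S by (auto simp: supported_from_def)
    have "(orient q c b + orient q a c) * (n \<bullet> (a - q)) \<le> orient q a b * (n \<bullet> (c - q))"
      unfolding orient_barycentric[of q a b n c] distrib_right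
      using mult_left_mono_neg[OF n(1) neg] by simp
    also have "\<dots> \<le> orient q a b * (n \<bullet> (a - q))"
      using pos n by (intro mult_left_mono) auto
    finally show ?thesis using K by simp
  qed
  then show ?thesis
    using orient_split[of a b c q] orient_swap[of q c b] orient_swap[of q c a] by linarith
qed

text \<open>Such a \<open>\<phi>\<close> lists \<open>S\<close> counterclockwise, starting anywhere: the points listed between \<open>a\<close> and \<open>b\<close> lie
  to the right of the directed line from \<open>a\<close> to \<open>b\<close>, the others to its left. The inequalities are
  weak because several points may lie on one side of the convex hull.\<close>

definition chord_order :: "(point \<Rightarrow> real) \<Rightarrow> point set \<Rightarrow> bool" where
  "chord_order \<phi> S \<longleftrightarrow> inj_on \<phi> S \<and>
     (\<forall>a\<in>S. \<forall>b\<in>S. \<forall>c\<in>S. \<phi> a < \<phi> b \<longrightarrow>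
        (\<phi> a < \<phi> c \<and> \<phi> c < \<phi> b \<longrightarrow> orient a b c \<le> 0) \<and>
        (\<phi> c < \<phi> a \<or> \<phi> b < \<phi> c \<longrightarrow> 0 \<le> orient a b c))"

lemma sin_pos_iff:
  fixes t :: real
  assumes "- (2 * pi) < t" "t < 2 * pi"
  shows "0 < sin t \<longleftrightarrow> 0 < t \<and> t < pi \<or> t < - pi"
proof -
  have "sin t < 0" if "pi < t" using sin_lt_zero that assms by auto
  moreover have "sin t < 0" if "- pi < t" "t < 0"
    using sin_gt_zero[of "- t"] that by simp
  moreover have "0 < sin t" if "t < - pi"
    using sin_lt_zero[of "- t"] that assms by simp
  moreover have "0 < sin t" if "0 < t" "t < pi" using sin_gt_zero that by auto
  moreover have "sin t = 0" if "t = 0 \<or> t = pi \<or> t = - pi" using that by auto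
  ultimately show ?thesis by (smt (verit))
qed

text \<open>The angle around \<open>q\<close> is a valid order. The two sector lemmas settle the case that the sector
  from \<open>a\<close> to \<open>b\<close> is smaller than a half-plane, and also that it is larger, since it is then the
  complement of the small sector from \<open>b\<close> to \<open>a\<close>. If it is a half-plane, then \<open>q\<close> lies on the segment
  \<open>a b\<close>, and the sine of the angle from \<open>a\<close> to \<open>c\<close> decides.\<close>

lemma chord_order_angle:
  assumes S: "supported_from q S"
  shows "\<exists>\<phi>. chord_order \<phi> S"
proof -
  define z where "z s = Complex (fst (s - q)) (snd (s - q))" for s
  define \<phi> where "\<phi> s = Arg (z s)" for s
  define r where "r s = cmod (z s)" for s
  have coords: "fst s - fst q = r s * cos (\<phi> s)" "snd s - snd q = r s * sin (\<phi> s)" for s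
  proof -
    have "rcis (r s) (\<phi> s) = z s" by (simp add: r_def \<phi>_def rcis_cmod_Arg)
    then have "Re (rcis (r s) (\<phi> s)) = fst s - fst q" "Im (rcis (r s) (\<phi> s)) = snd s - snd q"
      by (simp_all add: z_def)
    then show "fst s - fst q = r s * cos (\<phi> s)" "snd s - snd q = r s * sin (\<phi> s)"
      by (simp_all add: rcis_def)
  qed
  have cross: "orient q s t = r s * r t * sin (\<phi> t - \<phi> s)" for s t
    by (simp add: orient_def coords sin_diff algebra_simps)
  have range: "- pi < \<phi> s" "\<phi> s \<le> pi" for s
    using Arg_bounded by (auto simp: \<phi>_def)
  have r_pos: "0 < r s" if "s \<in> S" for s
  proof -
    have "s \<noteq> q" using that S by (force simp: supported_from_def)
    then have "z s \<noteq> 0" by (auto simp: z_def complex_eq_iff prod_eq_iff)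
    then show ?thesis by (simp add: r_def)
  qed
  have cross_pos: "0 < orient q s t \<longleftrightarrow> 0 < \<phi> t - \<phi> s \<and> \<phi> t - \<phi> s < pi \<or> \<phi> t - \<phi> s < - pi"
    if "s \<in> S" "t \<in> S" for s t
  proof -
    have "0 < orient q s t \<longleftrightarrow> 0 < sin (\<phi> t - \<phi> s)"
      using mult_less_cancel_left_pos[of "r s * r t" 0] r_pos that by (simp add: cross)
    then show ?thesis using sin_pos_iff[of "\<phi> t - \<phi> s"] range[of s] range[of t] by linarith
  qed
  have inj: "inj_on \<phi> S"
  proof (rule inj_onI)
    fix s t assume st: "s \<in> S" "t \<in> S" "\<phi> s = \<phi> t"
    have le: "r a \<le> r b" if ab: "a \<in> S" "b \<in> S" "\<phi> a = \<phi> b" for a b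
    proof -
      obtain n where n: "0 < n \<bullet> (b - q)" "n \<bullet> (a - q) \<le> n \<bullet> (b - q)"
        using S ab by (auto simp: supported_from_def)
      define h where "h = fst n * cos (\<phi> b) + snd n * sin (\<phi> b)"
      have "n \<bullet> (b - q) = r b * h" "n \<bullet> (a - q) = r a * h"
        using ab by (simp_all add: inner_prod_def coords h_def algebra_simps)
      then show ?thesis using n r_pos[OF ab(2)]
        by (simp add: zero_less_mult_iff)
    qed
    have "r s = r t" using le[of s t] le[of t s] st by simp
    then show "s = t" using coords[of s] coords[of t] st by (simp add: prod_eq_iff)
  qed
  have "(\<phi> a < \<phi> c \<and> \<phi> c < \<phi> b \<longrightarrow> orient a b c \<le> 0) \<and>
        (\<phi> c < \<phi> a \<or> \<phi> b < \<phi> c \<longrightarrow> 0 \<le> orient a b c)"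
    if abc: "a \<in> S" "b \<in> S" "c \<in> S" and less: "\<phi> a < \<phi> b" for a b c
  proof -
    consider "\<phi> b - \<phi> a < pi" | "\<phi> b - \<phi> a = pi" | "pi < \<phi> b - \<phi> a" by linarith
    then show ?thesis
    proof cases
      case 1
      then have pos: "0 < orient q a b" using cross_pos abc less by simp
      show ?thesis
      proof (intro conjI impI)
        assume "\<phi> a < \<phi> c \<and> \<phi> c < \<phi> b"
        then show "orient a b c \<le> 0"
          using 1 abc by (intro orient_in_sector[OF S]) (auto simp: cross_pos)
      next
        assume "\<phi> c < \<phi> a \<or> \<phi> b < \<phi> c"
        then have "\<not> (0 < orient q c b \<and> 0 < orient q a c)"
          using less 1 abc range[of a] range[of b] range[of c] by (auto simp: cross_pos)
        then show "0 \<le> orient a b c"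
          using pos abc by (intro orient_off_sector[OF S]) auto
      qed
    next
      case 2
      have "orient a b c = - ((r a + r b) * r c * sin (\<phi> c - \<phi> a))"
      proof -
        have "\<phi> b = \<phi> a + pi" using 2 by simp
        then show ?thesis
          by (simp add: orient_split[of a b c q] cross sin_diff sin_add cos_add algebra_simps)
      qed
      then have "orient a b c \<le> 0 \<longleftrightarrow> 0 \<le> (r a + r b) * r c * sin (\<phi> c - \<phi> a)"
        "0 \<le> orient a b c \<longleftrightarrow> (r a + r b) * r c * sin (\<phi> c - \<phi> a) \<le> 0" by simp_all
      moreover have "0 < (r a + r b) * r c" using r_pos abc by (simp add: add_pos_pos)
      ultimately have "orient a b c \<le> 0 \<longleftrightarrow> 0 \<le> sin (\<phi> c - \<phi> a)"
        "0 \<le> orient a b c \<longleftrightarrow> sin (\<phi> c - \<phi> a) \<le> 0"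
        using mult_le_cancel_left_pos[of "(r a + r b) * r c" 0 "sin (\<phi> c - \<phi> a)"]
          mult_le_cancel_left_pos[of "(r a + r b) * r c" "sin (\<phi> c - \<phi> a)" 0] by simp_all
      moreover have "0 < sin (\<phi> c - \<phi> a)" if "\<phi> a < \<phi> c" "\<phi> c < \<phi> b"
        using sin_gt_zero that 2 by simp
      moreover have "\<not> 0 < sin (\<phi> c - \<phi> a)" if "\<phi> c < \<phi> a \<or> \<phi> b < \<phi> c"
        using sin_pos_iff[of "\<phi> c - \<phi> a"] that 2 range[of a] range[of b] range[of c] by linarith
      ultimately show ?thesis by (simp add: less_imp_le not_less)
    next
      case 3
      then have pos: "0 < orient q b a" using cross_pos abc less by simp
      have "0 \<le> orient b a c" if "\<phi> a < \<phi> c \<and> \<phi> c < \<phi> b"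
      proof (rule orient_off_sector[OF S abc(2,1,3) pos])
        show "orient q c a \<le> 0 \<or> orient q b c \<le> 0"
          unfolding not_less[symmetric] using that 3 abc range[of a] range[of b]
          by (auto simp: cross_pos)
      qed
      moreover have "orient b a c \<le> 0" if "\<phi> c < \<phi> a \<or> \<phi> b < \<phi> c"
        using that 3 abc range[of a] range[of b] range[of c]
        by (intro orient_in_sector[OF S]) (auto simp: cross_pos)
      ultimately show ?thesis using orient_swap(2)[of b a c] by auto
    qed
  qed
  with inj have "chord_order \<phi> S" by (auto simp: chord_order_def)
  then show ?thesis by (rule exI[of _ \<phi>])
qed

text \<open>On a line all orientations vanish, so any injective parameter qualifies; the coordinate along the
  line is one.\<close>

lemma chord_order_line:
  assumes "n \<noteq> 0" "S \<subseteq> {x. n \<bullet> x = \<beta>}"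
  shows "\<exists>\<phi>. chord_order \<phi> S"
proof -
  define \<phi> :: "point \<Rightarrow> real" where "\<phi> s = fst n * snd s - snd n * fst s" for s
  have nn: "(fst n)\<^sup>2 + (snd n)\<^sup>2 \<noteq> 0" using assms(1) by (auto simp: prod_eq_iff sum_power2_eq_zero_iff)
  have coords: "((fst n)\<^sup>2 + (snd n)\<^sup>2) * fst s = fst n * \<beta> - snd n * \<phi> s"
    "((fst n)\<^sup>2 + (snd n)\<^sup>2) * snd s = snd n * \<beta> + fst n * \<phi> s" if "s \<in> S" for s
    using that assms(2) by (auto simp: \<phi>_def inner_prod_def power2_eq_square algebra_simps)
  have "inj_on \<phi> S"
  proof (rule inj_onI)
    fix s t assume st: "s \<in> S" "t \<in> S" "\<phi> s = \<phi> t"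
    let ?N = "(fst n)\<^sup>2 + (snd n)\<^sup>2"
    have "?N * fst s = ?N * fst t" "?N * snd s = ?N * snd t"
      using coords[OF st(1)] coords[OF st(2)] st(3) by simp_all
    then show "s = t" unfolding mult_left_cancel[OF nn] by (rule prod_eqI)
  qed
  moreover have "orient a b c = 0" if "a \<in> S" "b \<in> S" "c \<in> S" for a b c
  proof -
    have zero: "n \<bullet> (b - a) = 0" "n \<bullet> (c - a) = 0"
      using that assms(2) by (auto simp: inner_diff_right)
    have "fst n * orient a b c = (n \<bullet> (b - a)) * (snd c - snd a) - (n \<bullet> (c - a)) * (snd b - snd a)"
      "snd n * orient a b c = (n \<bullet> (c - a)) * (fst b - fst a) - (n \<bullet> (b - a)) * (fst c - fst a)"
      by (simp_all add: orient_def inner_prod_def algebra_simps)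
    then have "fst n * orient a b c = 0" "snd n * orient a b c = 0"
      using zero by simp_all
    then show ?thesis using assms(1) by (auto simp: prod_eq_iff)
  qed
  ultimately have "chord_order \<phi> S" by (simp add: chord_order_def)
  then show ?thesis by (rule exI[of _ \<phi>])
qed

lemma ex_chord_order:
  assumes "S \<subseteq> frontier (convex hull S)"
  shows "\<exists>\<phi>. chord_order \<phi> S"
proof (cases "interior (convex hull S) = {}")
  case True
  then obtain n \<beta> where "n \<noteq> 0" "convex hull S \<subseteq> {x. n \<bullet> x = \<beta>}"
    using empty_interior_subset_hyperplane[OF convex_convex_hull] by metis
  then show ?thesis using chord_order_line hull_subset by (metis subset_trans)
next
  case False
  then obtain q where q: "q \<in> interior (convex hull S)" by auto
  have ri: "rel_interior (convex hull S) = interior (convex hull S)"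
    using False by (rule rel_interior_nonempty_interior)
  have "supported_from q S"
    unfolding supported_from_def
  proof
    fix s assume s: "s \<in> S"
    then have "s \<notin> rel_interior (convex hull S)" using assms by (auto simp: ri frontier_def)
    then obtain m where "\<And>y. y \<in> convex hull S \<Longrightarrow> m \<bullet> s \<le> m \<bullet> y"
      and "\<And>y. y \<in> rel_interior (convex hull S) \<Longrightarrow> m \<bullet> s < m \<bullet> y"
      using supporting_hyperplane_rel_boundary[OF convex_convex_hull hull_inc[OF s]] by metis
    then have "0 < (- m) \<bullet> (s - q)" "\<forall>t\<in>S. (- m) \<bullet> (t - q) \<le> (- m) \<bullet> (s - q)"
      using q by (auto simp: ri hull_inc inner_diff_right)
    then show "\<exists>n. 0 < n \<bullet> (s - q) \<and> (\<forall>t\<in>S. n \<bullet> (t - q) \<le> n \<bullet> (s - q))" by blast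
  qed
  then show ?thesis by (rule chord_order_angle)
qed

section \<open>Crossing segments\<close>

lemma edge_segment_pair: "edge_segment p {a, b} = closed_segment (p a) (p b)"
  by (simp add: edge_segment_def segment_convex_hull)

lemma orient_convex_combination:
  assumes "u + v = 1"
  shows "orient a b (u *\<^sub>R c + v *\<^sub>R d) = u * orient a b c + v * orient a b d"
proof -
  have u: "u = 1 - v" using assms by simp
  show ?thesis unfolding u by (simp add: orient_def algebra_simps)
qed

lemma orient_eq_0_same [simp]: "orient a b a = 0" "orient a b b = 0" "orient a a b = 0"
  by (simp_all add: orient_def algebra_simps)

lemma orient_closed_segment:
  assumes "x \<in> closed_segment a b"
  shows "orient a b x = 0"
  using assms by (auto simp: in_segment orient_convex_combination)

lemma orient_eq_parallel:
  assumes "a \<noteq> b" "orient a b c = orient a b d"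
  shows "\<exists>k. d - c = k *\<^sub>R (b - a)"
proof -
  define w v where "w = b - a" and "v = d - c"
  have w: "w \<noteq> 0" using assms(1) by (simp add: w_def)
  have eq: "fst w * snd v = snd w * fst v"
    using assms(2) by (simp add: w_def v_def orient_def algebra_simps)
  have "\<exists>k. v = k *\<^sub>R w"
  proof (cases "fst w = 0")
    case False
    then show ?thesis using eq
      by (intro exI[of _ "fst v / fst w"]) (simp add: prod_eq_iff field_simps)
  next
    case True
    with w have "snd w \<noteq> 0" by (simp add: prod_eq_iff)
    then show ?thesis using eq True
      by (intro exI[of _ "snd v / snd w"]) (simp add: prod_eq_iff)
  qed
  then show ?thesis by (simp add: w_def v_def)
qed

text \<open>If the endpoints of the second segment were not strictly separated by the line through the first,
  both segments would lie on a common line and share more than the crossing point.\<close>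

lemma proper_crossing_orient:
  assumes "proper_crossing p {a, b} {c, d} x"
  shows "orient (p a) (p b) (p c) * orient (p a) (p b) (p d) < 0"
proof -
  define A B C D where "A = p a" and "B = p b" and "C = p c" and "D = p d"
  have int: "closed_segment A B \<inter> closed_segment C D = {x}"
    and ends: "x \<noteq> A" "x \<noteq> B" "x \<noteq> C" "x \<noteq> D"
    using assms by (auto simp: proper_crossing_def edge_segment_pair A_def B_def C_def D_def)
  from int have x: "x \<in> closed_segment A B" "x \<in> closed_segment C D" by auto
  from x(1) obtain s where s: "x = (1 - s) *\<^sub>R A + s *\<^sub>R B" "0 \<le> s" "s \<le> 1"
    by (auto simp: in_segment)
  from x(2) obtain t where t: "x = (1 - t) *\<^sub>R C + t *\<^sub>R D" "0 \<le> t" "t \<le> 1"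
    by (auto simp: in_segment)
  have "s \<noteq> 0" "s \<noteq> 1" "t \<noteq> 0" "t \<noteq> 1" using s t ends by auto
  with s t have st: "0 < s" "s < 1" "0 < t" "t < 1" by auto
  have AB: "A \<noteq> B" using s(1) ends by (auto simp: algebra_simps)
  have CD: "C \<noteq> D" using t(1) ends by (auto simp: algebra_simps)
  have zero: "(1 - t) * orient A B C + t * orient A B D = 0"
    using orient_closed_segment[OF x(1)]
      orient_convex_combination[of "1 - t" t A B C D] t(1) by simp
  have "orient A B C \<noteq> 0"
  proof
    assume 0: "orient A B C = 0"
    with zero st have "orient A B D = 0" by simp
    with 0 AB obtain k where k: "D - C = k *\<^sub>R (B - A)"
      using orient_eq_parallel[of A B C D] by auto
    have k0: "k \<noteq> 0" using k CD by auto
    \<comment> \<open>The two segments overlap along their common line near the crossing point.\<close>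
    define \<epsilon> where "\<epsilon> = min (1 - s) (\<bar>k\<bar> * min t (1 - t))"
    define y where "y = x + \<epsilon> *\<^sub>R (B - A)"
    have \<epsilon>: "0 < \<epsilon>" "\<epsilon> \<le> 1 - s" "\<epsilon> \<le> \<bar>k\<bar> * t" "\<epsilon> \<le> \<bar>k\<bar> * (1 - t)"
    proof -
      have "\<bar>k\<bar> * min t (1 - t) \<le> \<bar>k\<bar> * t" "\<bar>k\<bar> * min t (1 - t) \<le> \<bar>k\<bar> * (1 - t)"
        by (simp_all add: mult_left_mono)
      then show "\<epsilon> \<le> 1 - s" "\<epsilon> \<le> \<bar>k\<bar> * t" "\<epsilon> \<le> \<bar>k\<bar> * (1 - t)"
        unfolding \<epsilon>_def by linarith+
      show "0 < \<epsilon>" using st k0 by (simp add: \<epsilon>_def)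
    qed
    have "y = (1 - (s + \<epsilon>)) *\<^sub>R A + (s + \<epsilon>) *\<^sub>R B"
      by (simp add: y_def s(1) algebra_simps)
    then have "y \<in> closed_segment A B" 
      using st \<epsilon> unfolding in_segment by (intro exI[of _ "s + \<epsilon>"]) simp
    moreover have "y \<in> closed_segment C D"
    proof -
      have "\<epsilon> *\<^sub>R (B - A) = (\<epsilon> / k) *\<^sub>R (D - C)" using k k0 by simp
      then have "y = (1 - (t + \<epsilon> / k)) *\<^sub>R C + (t + \<epsilon> / k) *\<^sub>R D"
        by (simp add: y_def t(1) algebra_simps)
      moreover have "\<bar>\<epsilon> / k\<bar> \<le> t" "\<bar>\<epsilon> / k\<bar> \<le> 1 - t"
        using \<epsilon> k0 by (simp_all add: abs_divide pos_divide_le_eq mult.commute)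
      then have "0 \<le> t + \<epsilon> / k" "t + \<epsilon> / k \<le> 1" by linarith+
      ultimately show ?thesis
        unfolding in_segment by (intro exI[of _ "t + \<epsilon> / k"]) simp
    qed
    moreover have "y \<noteq> x" using \<epsilon>(1) AB by (simp add: y_def)
    ultimately show False using int by auto
  qed
  then have "0 < (1 - t) * (orient A B C)\<^sup>2" using st by simp
  moreover have "t * (orient A B C * orient A B D) = - ((1 - t) * (orient A B C)\<^sup>2)"
  proof -
    have "t * orient A B D = - ((1 - t) * orient A B C)" using zero by linarith
    then have "orient A B C * (t * orient A B D) = orient A B C * - ((1 - t) * orient A B C)" by simp
    then show ?thesis by (simp add: power2_eq_square algebra_simps)
  qed
  ultimately have "t * (orient A B C * orient A B D) < 0" by linarith
  then have "orient A B C * orient A B D < 0"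
    using st by (auto simp: mult_less_0_iff[of t])
  then show ?thesis by (simp add: A_def B_def C_def D_def)
qed

section \<open>Crossing edges interleave in a convex drawing\<close>

definition strictly_between :: "real \<Rightarrow> real \<Rightarrow> real \<Rightarrow> bool" where
  "strictly_between l r x \<longleftrightarrow> l < x \<and> x < r \<or> r < x \<and> x < l"

text \<open>In a chord order the side of the line \<open>a b\<close> on which a point lies is determined by whether the
  point is listed between \<open>a\<close> and \<open>b\<close>.\<close>

lemma chord_order_interleave:
  assumes \<phi>: "chord_order \<phi> S" and S: "a \<in> S" "b \<in> S" "c \<in> S" "d \<in> S"
    and opp: "orient a b c * orient a b d < 0"
  shows "strictly_between (\<phi> a) (\<phi> b) (\<phi> c) \<noteq> strictly_between (\<phi> a) (\<phi> b) (\<phi> d)"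
proof -
  have sep: "strictly_between (\<phi> a) (\<phi> b) (\<phi> c) \<noteq> strictly_between (\<phi> a) (\<phi> b) (\<phi> d)"
    if S: "a \<in> S" "b \<in> S" "c \<in> S" "d \<in> S"
      and opp: "orient a b c * orient a b d < 0" and less: "\<phi> a < \<phi> b" for a b
  proof -
    have inj: "\<phi> u = \<phi> v \<longleftrightarrow> u = v" if "u \<in> S" "v \<in> S" for u v
      using \<phi> that by (auto simp: chord_order_def inj_on_def)
    have sign: "orient a b u < 0 \<longleftrightarrow> strictly_between (\<phi> a) (\<phi> b) (\<phi> u)" if u: "u \<in> S" "orient a b u \<noteq> 0" for u
    proof -
      have "u \<noteq> a" "u \<noteq> b" using u by auto
      then have "\<phi> u \<noteq> \<phi> a" "\<phi> u \<noteq> \<phi> b" using inj u S by auto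
      moreover have "\<phi> a < \<phi> u \<and> \<phi> u < \<phi> b \<longrightarrow> orient a b u \<le> 0"
        "\<phi> u < \<phi> a \<or> \<phi> b < \<phi> u \<longrightarrow> 0 \<le> orient a b u"
        using \<phi> S u less unfolding chord_order_def by blast+
      ultimately show ?thesis using u less unfolding strictly_between_def by linarith
    qed
    from opp have "orient a b c \<noteq> 0" "orient a b d \<noteq> 0" by auto
    then show ?thesis
      using sign[OF S(3)] sign[OF S(4)] opp by (auto simp: mult_less_0_iff)
  qed
  have "\<phi> a \<noteq> \<phi> b"
  proof
    assume "\<phi> a = \<phi> b"
    then have "a = b" using \<phi> S by (auto simp: chord_order_def inj_on_def)
    with opp show False by simp
  qed
  then consider "\<phi> a < \<phi> b" | "\<phi> b < \<phi> a" by linarith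
  then show ?thesis
  proof cases
    case 1
    then show ?thesis using sep S opp by blast
  next
    case 2
    moreover have "orient b a c * orient b a d < 0"
      using opp by (simp add: orient_swap(2)[of b a])
    ultimately have "strictly_between (\<phi> b) (\<phi> a) (\<phi> c) \<noteq> strictly_between (\<phi> b) (\<phi> a) (\<phi> d)"
      using sep S by blast
    then show ?thesis by (auto simp: strictly_between_def)
  qed
qed

lemma convex_drawing_vertex_order:
  assumes "convex_drawing G p"
  shows "\<exists>\<omega> :: 'a \<Rightarrow> real. inj_on \<omega> (verts G) \<and>
     (\<forall>a b c d x. {a, b, c, d} \<subseteq> verts G \<and> proper_crossing p {a, b} {c, d} x \<longrightarrow>
        strictly_between (\<omega> a) (\<omega> b) (\<omega> c) \<noteq> strictly_between (\<omega> a) (\<omega> b) (\<omega> d))"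
proof -
  from assms obtain \<phi> where \<phi>: "chord_order \<phi> (p ` verts G)"
    using ex_chord_order unfolding convex_drawing_def by blast
  have "inj_on (\<phi> \<circ> p) (verts G)"
    using assms \<phi> by (intro comp_inj_on) (auto simp: convex_drawing_def geometric_drawing_def chord_order_def)
  moreover have "strictly_between (\<phi> (p a)) (\<phi> (p b)) (\<phi> (p c)) \<noteq> strictly_between (\<phi> (p a)) (\<phi> (p b)) (\<phi> (p d))"
    if "{a, b, c, d} \<subseteq> verts G" "proper_crossing p {a, b} {c, d} x" for a b c d x
    using that by (intro chord_order_interleave[OF \<phi>] proper_crossing_orient) auto
  ultimately show ?thesis
    by (intro exI[of _ "\<phi> \<circ> p"]) (unfold o_apply, blast)
qed

section \<open>Drawings with no vertex on the line of an edge\<close>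

lemma card_2_pair: "card e = 2 \<Longrightarrow> \<exists>a b. e = {a, b} \<and> a \<noteq> b"
  by (auto simp: card_2_iff)

lemma card_2_pair_at: "card e = 2 \<Longrightarrow> v \<in> e \<Longrightarrow> \<exists>b. e = {v, b} \<and> v \<noteq> b"
  by (auto simp: card_2_iff)

text \<open>If the line through an edge contains no vertex besides its two ends, then no two edges are collinear,
  so they meet at most once, and only at a common vertex or at a proper crossing.\<close>

lemma geometric_drawingI:
  assumes G: "simple_graph G" and inj: "inj_on p (verts G)"
    and off_line: "\<And>e. e \<in> edges G \<Longrightarrow>
      \<exists>a b. e = {a, b} \<and> (\<forall>v\<in>verts G - e. orient (p a) (p b) (p v) \<noteq> 0)"
  shows "geometric_drawing G p"
proof -
  have noncoll: "orient (p a) (p b) (p v) \<noteq> 0"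
    if "{a, b} \<in> edges G" "v \<in> verts G" "v \<noteq> a" "v \<noteq> b" for a b v
    using off_line[OF that(1)] that(2-4) orient_swap(2)[of "p b" "p a" "p v"]
    by (auto simp: doubleton_eq_iff)
  have edge: "\<exists>a b. e = {a, b} \<and> a \<noteq> b \<and> a \<in> verts G \<and> b \<in> verts G" if "e \<in> edges G" for e
  proof -
    have "card e = 2" "e \<subseteq> verts G" using G that by (auto simp: simple_graph_def)
    then show ?thesis using card_2_pair[of e] by auto
  qed
  have off: "p v \<notin> edge_segment p e" if ev: "e \<in> edges G" "v \<in> verts G - e" for e v
  proof -
    obtain a b where "e = {a, b}" using edge[OF ev(1)] by blast
    then show ?thesis
      using ev noncoll[of a b v] orient_closed_segment[of "p v" "p a" "p b"]
      by (auto simp: edge_segment_pair)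
  qed
  have meet: "x \<in> p ` (e \<inter> f) \<or> proper_crossing p e f x"
    if ef: "e \<in> edges G" "f \<in> edges G" "e \<noteq> f" and x: "x \<in> edge_segment p e" "x \<in> edge_segment p f"
    for e f x
  proof (cases "e \<inter> f = {}")
    case True
    obtain a b where e: "e = {a, b}" and ab: "a \<in> verts G" "b \<in> verts G" using edge[OF ef(1)] by blast
    obtain c d where f: "f = {c, d}" and cd: "c \<in> verts G" "d \<in> verts G" using edge[OF ef(2)] by blast
    have unique: "y = x" if y: "y \<in> edge_segment p e" "y \<in> edge_segment p f" for y
    proof -
      obtain s t where s: "x = (1 - s) *\<^sub>R p c + s *\<^sub>R p d" and t: "y = (1 - t) *\<^sub>R p c + t *\<^sub>R p d"
        using x(2) y(2) by (auto simp: f edge_segment_pair in_segment)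
      have "orient (p a) (p b) x = 0" "orient (p a) (p b) y = 0"
        using x(1) y(1) by (simp_all add: e edge_segment_pair orient_closed_segment)
      then have 1: "(1 - s) * orient (p a) (p b) (p c) + s * orient (p a) (p b) (p d) = 0"
        and 2: "(1 - t) * orient (p a) (p b) (p c) + t * orient (p a) (p b) (p d) = 0"
        by (simp_all add: s t orient_convex_combination)
      let ?c = "orient (p a) (p b) (p c)" and ?d = "orient (p a) (p b) (p d)"
      have "(s - t) * ?c = s * ((1 - t) * ?c + t * ?d) - t * ((1 - s) * ?c + s * ?d)"
        by (simp add: algebra_simps)
      also have "\<dots> = 0" by (simp only: 1 2 mult_zero_right diff_self)
      finally have "s = t \<or> ?c = 0" by simp
      moreover have "orient (p a) (p b) (p c) \<noteq> 0"
        using noncoll[of a b c] ef(1) cd True by (auto simp: e f)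
      ultimately show "y = x" by (auto simp: s t)
    qed
    have "edge_segment p e \<inter> edge_segment p f = {x}" using x unique by blast
    moreover have "x \<notin> p ` e" using off[OF ef(2)] True x(2) ab by (auto simp: e)
    moreover have "x \<notin> p ` f" using off[OF ef(1)] True x(1) cd by (auto simp: f)
    ultimately show ?thesis by (simp add: proper_crossing_def)
  next
    case False
    then obtain a where a: "a \<in> e" "a \<in> f" by auto
    obtain b where e: "e = {a, b}" "a \<noteq> b"
      using edge[OF ef(1)] a(1) by (metis insert_commute insert_iff singletonD)
    obtain d where f: "f = {a, d}" "d \<in> verts G" "a \<noteq> d"
      using edge[OF ef(2)] a(2) by (metis insert_commute insert_iff singletonD)
    obtain t where t: "x = (1 - t) *\<^sub>R p a + t *\<^sub>R p d"
      using x(2) by (auto simp: f edge_segment_pair in_segment)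
    have "orient (p a) (p b) x = 0" using x(1) by (simp add: e edge_segment_pair orient_closed_segment)
    then have "t * orient (p a) (p b) (p d) = 0" by (simp add: t orient_convex_combination)
    moreover have "orient (p a) (p b) (p d) \<noteq> 0" using noncoll[of a b d] ef e f by auto
    ultimately have "x = p a" by (simp add: t)
    then show ?thesis using a by blast
  qed
  show ?thesis
    unfolding geometric_drawing_def
  proof (intro conjI ballI impI)
    fix e f x assume "e \<in> edges G" "f \<in> edges G" "e \<noteq> f" "x \<in> edge_segment p e \<inter> edge_segment p f"
    then show "x \<in> p ` (e \<inter> f) \<or> proper_crossing p e f x" by (intro meet) auto
  qed (use inj off in auto)
qed

text \<open>The parameters of the meeting point on both segments are quotients of orientations with the same
  denominator up to sign.\<close>

lemma segments_cross:
  assumes cd: "orient a b c * orient a b d < 0" and ab: "orient c d a * orient c d b < 0"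
  shows "closed_segment a b \<inter> closed_segment c d \<noteq> {}"
proof -
  define \<delta> where "\<delta> = orient c d a - orient c d b"
  have \<delta>': "\<delta> = orient a b d - orient a b c" by (simp add: \<delta>_def orient_def algebra_simps)
  define s where "s = orient c d a / \<delta>"
  define t where "t = - orient a b c / \<delta>"
  have \<delta>0: "\<delta> \<noteq> 0" using ab by (auto simp: \<delta>_def)
  have s: "0 \<le> s" "s \<le> 1" using ab by (auto simp: s_def \<delta>_def mult_less_0_iff divide_simps)
  have t: "0 \<le> t" "t \<le> 1" using cd by (auto simp: t_def \<delta>' mult_less_0_iff divide_simps)
  have "fst ((1 - s) *\<^sub>R a + s *\<^sub>R b) * \<delta> = fst ((1 - t) *\<^sub>R c + t *\<^sub>R d) * \<delta>"
    "snd ((1 - s) *\<^sub>R a + s *\<^sub>R b) * \<delta> = snd ((1 - t) *\<^sub>R c + t *\<^sub>R d) * \<delta>"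
  proof -
    have st: "s * \<delta> = orient c d a" "t * \<delta> = - orient a b c" using \<delta>0 by (simp_all add: s_def t_def)
    have "fst ((1 - s) *\<^sub>R a + s *\<^sub>R b) * \<delta> = fst a * \<delta> + (s * \<delta>) * (fst b - fst a)"
      "snd ((1 - s) *\<^sub>R a + s *\<^sub>R b) * \<delta> = snd a * \<delta> + (s * \<delta>) * (snd b - snd a)"
      "fst ((1 - t) *\<^sub>R c + t *\<^sub>R d) * \<delta> = fst c * \<delta> + (t * \<delta>) * (fst d - fst c)"
      "snd ((1 - t) *\<^sub>R c + t *\<^sub>R d) * \<delta> = snd c * \<delta> + (t * \<delta>) * (snd d - snd c)"
      by (simp_all add: algebra_simps)
    note eqs = this
    show "fst ((1 - s) *\<^sub>R a + s *\<^sub>R b) * \<delta> = fst ((1 - t) *\<^sub>R c + t *\<^sub>R d) * \<delta>"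
      "snd ((1 - s) *\<^sub>R a + s *\<^sub>R b) * \<delta> = snd ((1 - t) *\<^sub>R c + t *\<^sub>R d) * \<delta>"
      unfolding eqs st by (simp_all add: \<delta>_def orient_def algebra_simps)
  qed
  then have "(1 - s) *\<^sub>R a + s *\<^sub>R b = (1 - t) *\<^sub>R c + t *\<^sub>R d"
    using \<delta>0 by (intro prod_eqI) simp_all
  moreover have "(1 - s) *\<^sub>R a + s *\<^sub>R b \<in> closed_segment a b"
    "(1 - t) *\<^sub>R c + t *\<^sub>R d \<in> closed_segment c d"
    using s t by (auto simp: in_segment)
  ultimately show ?thesis by auto
qed

text \<open>In a drawing, edges with a common endpoint always meet exactly once, and disjoint edges at most once.
  So a thrackle only needs its disjoint edges to meet.\<close>

lemma thrackleI:
  assumes G: "simple_graph G" "geometric_drawing G p" and F: "F \<subseteq> edges G"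
    and meet: "\<And>e f. e \<in> F \<Longrightarrow> f \<in> F \<Longrightarrow> e \<inter> f = {} \<Longrightarrow> edge_segment p e \<inter> edge_segment p f \<noteq> {}"
  shows "thrackle p F"
  unfolding thrackle_def
proof (intro ballI impI)
  fix e f assume ef: "e \<in> F" "f \<in> F" "e \<noteq> f"
  then have E: "e \<in> edges G" "f \<in> edges G" using F by auto
  have int: "x \<in> p ` (e \<inter> f) \<or> proper_crossing p e f x"
    if "x \<in> edge_segment p e \<inter> edge_segment p f" for x
    using G(2) E ef(3) that by (auto simp: geometric_drawing_def)
  show "\<exists>x. edge_segment p e \<inter> edge_segment p f = {x} \<and>
      (x \<in> p ` (e \<inter> f) \<or> proper_crossing p e f x)"
  proof (cases "e \<inter> f = {}")
    case True
    then obtain x where x: "x \<in> edge_segment p e \<inter> edge_segment p f" using meet ef by blast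
    then have "proper_crossing p e f x" using int True by blast
    then show ?thesis by (auto simp: proper_crossing_def)
  next
    case False
    then obtain v where v: "v \<in> e" "v \<in> f" by auto
    have card: "card e = 2" "card f = 2" using G(1) E by (auto simp: simple_graph_def)
    obtain b where "e = {v, b}" using card_2_pair_at[OF card(1) v(1)] by blast
    moreover obtain d where "f = {v, d}" using card_2_pair_at[OF card(2) v(2)] by blast
    ultimately have ef_v: "e \<inter> f = {v}" using ef(3) by auto
    have pv: "p v \<in> edge_segment p e \<inter> edge_segment p f"
      using v by (auto simp: edge_segment_def hull_inc)
    have "x = p v" if "x \<in> edge_segment p e \<inter> edge_segment p f" for x
    proof (rule ccontr)
      assume "x \<noteq> p v"
      then have "proper_crossing p e f x" using int[OF that] ef_v by auto
      then show False using pv v \<open>x \<noteq> p v\<close> by (auto simp: proper_crossing_def)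
    qed
    with pv have "edge_segment p e \<inter> edge_segment p f = {p v}" by blast
    then show ?thesis using ef_v by auto
  qed
qed

text \<open>Placing the vertices on a parabola makes the orientations Vandermonde products and gives every
  vertex its tangent as a supporting line. Without a convex drawing the least number that defines
  the convex antithickness would be arbitrary.\<close>

lemma ex_convex_drawing:
  assumes G: "simple_graph G"
  shows "\<exists>p. convex_drawing G p"
proof -
  obtain f :: "'a \<Rightarrow> nat" where f: "inj_on f (verts G)"
    using finite_imp_inj_to_nat_seg[of "verts G"] G by (auto simp: simple_graph_def)
  define p where "p v = (real (f v), (real (f v))\<^sup>2)" for v
  have orient: "orient (p a) (p b) (p v) =
      (real (f b) - real (f a)) * (real (f v) - real (f a)) * (real (f v) - real (f b))" for a b v
    by (simp add: orient_def p_def power2_eq_square algebra_simps)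
  have "geometric_drawing G p"
  proof (rule geometric_drawingI[OF G])
    show "inj_on p (verts G)" using f by (auto simp: inj_on_def p_def)
  next
    fix e assume "e \<in> edges G"
    then have "card e = 2" "e \<subseteq> verts G" using G by (auto simp: simple_graph_def)
    then obtain a b where "e = {a, b}" "a \<noteq> b" "a \<in> verts G" "b \<in> verts G"
      using card_2_pair[of e] by auto
    then show "\<exists>a b. e = {a, b} \<and> (\<forall>v\<in>verts G - e. orient (p a) (p b) (p v) \<noteq> 0)"
      using f by (intro exI[of _ a] exI[of _ b]) (auto simp: orient inj_on_def)
  qed
  moreover have "p v \<in> frontier (convex hull (p ` verts G))" if v: "v \<in> verts G" for v
  proof -
    let ?t = "real (f v)" let ?H = "{z. (2 * ?t, -1) \<bullet> z \<le> ?t\<^sup>2} :: point set"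
    have "p ` verts G \<subseteq> ?H"
    proof -
      have "(2 * ?t, -1) \<bullet> p w \<le> ?t\<^sup>2" for w
      proof -
        have "0 \<le> (real (f w) - ?t)\<^sup>2" by simp
        then show ?thesis by (simp add: inner_prod_def p_def power2_eq_square algebra_simps)
      qed
      then show ?thesis by blast
    qed
    then have "convex hull (p ` verts G) \<subseteq> ?H"
      by (intro hull_minimal convex_halfspace_le)
    then have "interior (convex hull (p ` verts G)) \<subseteq> interior ?H" by (rule interior_mono)
    also have "interior ?H = {z. (2 * ?t, -1) \<bullet> z < ?t\<^sup>2}"
      by (intro interior_halfspace_le) (simp add: prod_eq_iff)
    finally have "p v \<notin> interior (convex hull (p ` verts G))"
      by (auto simp: inner_prod_def p_def power2_eq_square)
    moreover have "p v \<in> convex hull (p ` verts G)" using v by (simp add: hull_inc)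
    ultimately show ?thesis
      unfolding frontier_def using closure_subset[of "convex hull (p ` verts G)"] by blast
  qed
  ultimately show ?thesis by (auto simp: convex_drawing_def)
qed

section \<open>Nested paths force many thrackles\<close>

text \<open>The combinatorial content of a convex drawing with antithickness \<open>k\<close>; the lower bounds use nothing
  else about the drawing.\<close>

definition interleaved_colouring :: "'a graph \<Rightarrow> nat \<Rightarrow> ('a \<Rightarrow> real) \<Rightarrow> ('a set \<Rightarrow> nat) \<Rightarrow> bool" where
  "interleaved_colouring G k \<omega> col \<longleftrightarrow> inj_on \<omega> (verts G) \<and> col ` edges G \<subseteq> {..<k} \<and>
     (\<forall>a b c d. {a, b} \<in> edges G \<and> {c, d} \<in> edges G \<and> {a, b} \<inter> {c, d} = {} \<and>
        col {a, b} = col {c, d} \<longrightarrow>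
        strictly_between (\<omega> a) (\<omega> b) (\<omega> c) \<noteq> strictly_between (\<omega> a) (\<omega> b) (\<omega> d))"

lemma drawing_antithickness_attained:
  assumes "finite (edges G)"
  shows "0 < drawing_antithickness G p \<and> (\<exists>col :: 'a set \<Rightarrow> nat.
    col ` edges G \<subseteq> {..<drawing_antithickness G p} \<and>
    (\<forall>i<drawing_antithickness G p. thrackle p {e \<in> edges G. col e = i}))"
  unfolding drawing_antithickness_def
proof (rule LeastI_ex)
  obtain col :: "'a set \<Rightarrow> nat" and n where col: "col ` edges G = {..<n}" "inj_on col (edges G)"
    using finite_imp_inj_to_nat_seg[OF assms] by (auto simp: lessThan_def)
  have "thrackle p {e \<in> edges G. col e = i}" for i
    using col(2) by (auto simp: thrackle_def inj_on_def)
  moreover have "col ` edges G \<subseteq> {..<Suc n}" unfolding col(1) by auto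
  ultimately show "\<exists>k. 0 < k \<and> (\<exists>col :: 'a set \<Rightarrow> nat. col ` edges G \<subseteq> {..<k} \<and>
      (\<forall>i<k. thrackle p {e \<in> edges G. col e = i}))"
    by blast
qed

lemma simple_graph_finite_edges: "simple_graph G \<Longrightarrow> finite (edges G)"
  by (rule finite_subset[of _ "Pow (verts G)"]) (auto simp: simple_graph_def)

lemma thrackle_crossing:
  assumes "thrackle p F" "e \<in> F" "f \<in> F" "e \<noteq> {}" "e \<inter> f = {}"
  shows "\<exists>x. proper_crossing p e f x"
  using assms by (fastforce simp: thrackle_def)

lemma convex_antithickness_colouring:
  assumes G: "simple_graph G"
  shows "0 < convex_antithickness G \<and>
    (\<exists>\<omega> col. interleaved_colouring G (convex_antithickness G) \<omega> col)"
proof -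
  let ?k = "convex_antithickness G"
  have "\<exists>k. 0 < k \<and> (\<exists>p. convex_drawing G p \<and> drawing_antithickness G p = k)"
    using ex_convex_drawing[OF G] drawing_antithickness_attained[OF simple_graph_finite_edges[OF G]]
    by blast
  then have "0 < ?k \<and> (\<exists>p. convex_drawing G p \<and> drawing_antithickness G p = ?k)"
    unfolding convex_antithickness_def by (rule LeastI_ex)
  then obtain p where k: "0 < ?k" and p: "convex_drawing G p" "drawing_antithickness G p = ?k"
    by blast
  obtain col where col: "col ` edges G \<subseteq> {..<?k}"
    "\<And>i. i < ?k \<Longrightarrow> thrackle p {e \<in> edges G. col e = i}"
    using drawing_antithickness_attained[OF simple_graph_finite_edges[OF G], of p] p(2) by auto
  obtain \<omega> :: "'a \<Rightarrow> real" where inj: "inj_on \<omega> (verts G)"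
    and \<omega>: "\<And>a b c d x. {a, b, c, d} \<subseteq> verts G \<Longrightarrow> proper_crossing p {a, b} {c, d} x \<Longrightarrow>
      strictly_between (\<omega> a) (\<omega> b) (\<omega> c) \<noteq> strictly_between (\<omega> a) (\<omega> b) (\<omega> d)"
    using convex_drawing_vertex_order[OF p(1)] by blast
  have "strictly_between (\<omega> a) (\<omega> b) (\<omega> c) \<noteq> strictly_between (\<omega> a) (\<omega> b) (\<omega> d)"
    if e: "{a, b} \<in> edges G" "{c, d} \<in> edges G" "{a, b} \<inter> {c, d} = {}" "col {a, b} = col {c, d}"
    for a b c d
  proof -
    have "col {a, b} < ?k" using col(1) e(1) by auto
    then obtain x where "proper_crossing p {a, b} {c, d} x"
      using thrackle_crossing[OF col(2), of "col {a, b}" "{a, b}" "{c, d}"] e by auto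
    moreover have "{a, b, c, d} \<subseteq> verts G" using G e(1,2) by (auto simp: simple_graph_def)
    ultimately show ?thesis using \<omega> by blast
  qed
  then have "interleaved_colouring G ?k \<omega> col"
    unfolding interleaved_colouring_def using inj col(1) by blast
  then show ?thesis using k by blast
qed

text \<open>Two disjoint paths \<open>v x w\<close> and \<open>v' y w'\<close> with \<open>v < v' < w' < w\<close>, such that \<open>v x\<close> crosses \<open>v' y\<close> and \<open>w x\<close>
  crosses \<open>w' y\<close>, cannot both have their middle vertex between their ends, nor both outside. If
  both are between, the first crossing forces \<open>x < y\<close> and the second \<open>y < x\<close>. If \<open>x\<close> is outside, say
  \<open>x < v\<close>, then \<open>v'\<close> is not between \<open>x\<close> and \<open>v\<close>, so the first crossing gives \<open>x < y < v\<close>; but then both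
  \<open>w'\<close> and \<open>y\<close> are between \<open>x\<close> and \<open>w\<close>, against the second.\<close>

lemma nested_paths_differ:
  assumes "v < v'" "v' < w'" "w' < w" and "distinct [x, y, v, v', w, w']"
    and "strictly_between v x v' \<noteq> strictly_between v x y"
    and "strictly_between w x w' \<noteq> strictly_between w x y"
  shows "strictly_between v w x \<noteq> strictly_between v' w' y"
  using assms unfolding strictly_between_def by (smt (verit) distinct_length_2_or_more)

text \<open>A nested path is determined by the colours of its two edges and by whether its middle vertex lies
  between its ends, so there are at most \<open>2 k\<^sup>2\<close> of them.\<close>

lemma nested_paths_bound:
  assumes G: "simple_graph G" and \<omega>: "interleaved_colouring G k \<omega> col"
    and paths: "\<And>i. i < h \<Longrightarrow> {v i, x i} \<in> edges G \<and> {w i, x i} \<in> edges G"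
    and nested: "\<And>i j. i < j \<Longrightarrow> j < h \<Longrightarrow> \<omega> (v i) < \<omega> (v j) \<and> \<omega> (v j) < \<omega> (w j) \<and> \<omega> (w j) < \<omega> (w i)"
    and off: "\<And>i j. i < h \<Longrightarrow> j < h \<Longrightarrow> x i \<noteq> v j \<and> x i \<noteq> w j"
    and inj: "inj_on x {..<h}"
  shows "h \<le> 2 * k\<^sup>2"
proof -
  define T where "T i = (strictly_between (\<omega> (v i)) (\<omega> (w i)) (\<omega> (x i)), col {v i, x i}, col {w i, x i})" for i
  have V: "v i \<in> verts G" "x i \<in> verts G" "w i \<in> verts G" if "i < h" for i
    using paths[OF that] G by (auto simp: simple_graph_def)
  have \<omega>_eq: "\<omega> a = \<omega> b \<longleftrightarrow> a = b" if "a \<in> verts G" "b \<in> verts G" for a b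
    using \<omega> that by (auto simp: interleaved_colouring_def inj_on_def)
  have interleave: "strictly_between (\<omega> a) (\<omega> b) (\<omega> c) \<noteq> strictly_between (\<omega> a) (\<omega> b) (\<omega> d)"
    if "{a, b} \<in> edges G" "{c, d} \<in> edges G" "{a, b} \<inter> {c, d} = {}" "col {a, b} = col {c, d}"
    for a b c d
    using \<omega> that unfolding interleaved_colouring_def by blast
  have differ: "T i \<noteq> T j" if ij: "i < j" "j < h" for i j
  proof
    assume T: "T i = T j"
    have i: "i < h" using ij by simp
    have xx: "x i \<noteq> x j" using inj ij i by (auto simp: inj_on_def)
    note off' = off[OF i i] off[OF i ij(2)] off[OF ij(2) i] off[OF ij(2) ij(2)]
    have order: "\<omega> (v i) < \<omega> (v j)" "\<omega> (v j) < \<omega> (w j)" "\<omega> (w j) < \<omega> (w i)"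
      using nested[OF ij] by auto
    have dist: "distinct [\<omega> (x i), \<omega> (x j), \<omega> (v i), \<omega> (v j), \<omega> (w i), \<omega> (w j)]"
      using order xx off' V[OF i] V[OF ij(2)] by (auto simp: \<omega>_eq)
    then have ne: "v i \<noteq> v j" "w i \<noteq> w j" by auto
    have "strictly_between (\<omega> (v i)) (\<omega> (x i)) (\<omega> (v j)) \<noteq> strictly_between (\<omega> (v i)) (\<omega> (x i)) (\<omega> (x j))"
      "strictly_between (\<omega> (w i)) (\<omega> (x i)) (\<omega> (w j)) \<noteq> strictly_between (\<omega> (w i)) (\<omega> (x i)) (\<omega> (x j))"
      using paths[OF i] paths[OF ij(2)] T ne xx off' unfolding T_def
      by (intro interleave; auto)+
    from nested_paths_differ[OF order dist this] T show False by (simp add: T_def)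
  qed
  have "inj_on T {..<h}"
  proof (rule inj_onI, rule ccontr)
    fix i j assume "i \<in> {..<h}" "j \<in> {..<h}" "T i = T j" "i \<noteq> j"
    then show False using differ[of i j] differ[of j i] by (cases "i < j") auto
  qed
  moreover have "T ` {..<h} \<subseteq> UNIV \<times> {..<k} \<times> {..<k}"
    using paths \<omega> by (auto simp: T_def interleaved_colouring_def)
  ultimately have "card {..<h} \<le> card ((UNIV :: bool set) \<times> {..<k} \<times> {..<k})"
    by (intro card_inj_on_le) auto
  then show ?thesis by (simp add: card_cartesian_product power2_eq_square)
qed

lemma increasing_enumeration:
  fixes \<omega> :: "'a \<Rightarrow> real"
  assumes S: "finite S" "inj_on \<omega> S"
  shows "\<exists>f. bij_betw f {..<card S} S \<and> (\<forall>i j. i < j \<and> j < card S \<longrightarrow> \<omega> (f i) < \<omega> (f j))"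
proof -
  define xs where "xs = sorted_list_of_set (\<omega> ` S)"
  have len: "length xs = card S" and set: "set xs = \<omega> ` S" and sorted: "sorted_wrt (<) xs"
    using S by (simp_all add: xs_def card_image)
  have "bij_betw ((!) xs) {..<card S} (\<omega> ` S)"
    using bij_betw_nth[of xs "{..<card S}" "\<omega> ` S"] len set sorted by (simp add: strict_sorted_iff)
  moreover have "bij_betw (inv_into S \<omega>) (\<omega> ` S) S"
    using S(2) by (intro bij_betw_inv_into) (simp add: bij_betw_def)
  ultimately have "bij_betw (inv_into S \<omega> \<circ> (!) xs) {..<card S} S" by (rule bij_betw_trans)
  moreover have "\<omega> (inv_into S \<omega> (xs ! i)) = xs ! i" if "i < card S" for i
    using that len set nth_mem[of i xs] by (intro f_inv_into_f) auto
  then have "\<omega> ((inv_into S \<omega> \<circ> (!) xs) i) < \<omega> ((inv_into S \<omega> \<circ> (!) xs) j)" if "i < j" "j < card S" for i j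
    using that sorted_wrt_nth_less[OF sorted that(1)] len by simp
  ultimately show ?thesis by blast
qed

text \<open>A subdivided complete bipartite graph with sides \<open>P\<close> and \<open>Q\<close> in \<open>G\<close>, not necessarily induced;
  \<open>m u w\<close> is the division vertex of the edge between \<open>u\<close> and \<open>w\<close>.\<close>

definition subdivided_biclique :: "'a graph \<Rightarrow> 'a set \<Rightarrow> 'a set \<Rightarrow> ('a \<Rightarrow> 'a \<Rightarrow> 'a) \<Rightarrow> bool" where
  "subdivided_biclique G P Q m \<longleftrightarrow> P \<union> Q \<subseteq> verts G \<and> inj_on (\<lambda>(u, w). m u w) (P \<times> Q) \<and>
     (\<forall>u\<in>P. \<forall>w\<in>Q. m u w \<notin> P \<union> Q \<and> {u, m u w} \<in> edges G \<and> {w, m u w} \<in> edges G)"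

lemma subdivided_biclique_subset:
  assumes "subdivided_biclique G P Q m" "P' \<subseteq> P" "Q' \<subseteq> Q"
  shows "subdivided_biclique G P' Q' m"
proof -
  have "inj_on (\<lambda>(u, w). m u w) (P' \<times> Q')"
    using assms unfolding subdivided_biclique_def by (intro inj_on_subset[of _ "P \<times> Q" "P' \<times> Q'"]) auto
  with assms show ?thesis unfolding subdivided_biclique_def by blast
qed

lemma subdivided_biclique_swap:
  assumes "subdivided_biclique G P Q m"
  shows "subdivided_biclique G Q P (\<lambda>u w. m w u)"
  using assms by (auto simp: subdivided_biclique_def inj_on_def)

text \<open>When \<open>P\<close> precedes \<open>Q\<close>, joining the first vertex of \<open>P\<close> to the last of \<open>Q\<close>, the second to the last
  but one, and so on, gives \<open>h\<close> nested paths.\<close>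

lemma separated_biclique_bound:
  assumes G: "simple_graph G" and \<omega>: "interleaved_colouring G k \<omega> col"
    and K: "subdivided_biclique G P Q m" and card: "card P = h" "card Q = h"
    and less: "\<And>u w. u \<in> P \<Longrightarrow> w \<in> Q \<Longrightarrow> \<omega> u < \<omega> w"
  shows "h \<le> 2 * k\<^sup>2"
proof -
  have V: "P \<subseteq> verts G" "Q \<subseteq> verts G" using K by (auto simp: subdivided_biclique_def)
  then have fin: "finite P" "finite Q" using G finite_subset by (auto simp: simple_graph_def)
  have inj: "inj_on \<omega> P" "inj_on \<omega> Q"
    using \<omega> V inj_on_subset by (auto simp: interleaved_colouring_def)
  obtain f where f: "bij_betw f {..<h} P" "\<And>i j. i < j \<Longrightarrow> j < h \<Longrightarrow> \<omega> (f i) < \<omega> (f j)"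
    using increasing_enumeration[OF fin(1) inj(1)] card(1) by auto
  obtain g where g: "bij_betw g {..<h} Q" "\<And>i j. i < j \<Longrightarrow> j < h \<Longrightarrow> \<omega> (g i) < \<omega> (g j)"
    using increasing_enumeration[OF fin(2) inj(2)] card(2) by auto
  define w where "w i = g (h - Suc i)" for i
  have P: "f i \<in> P" and Q: "w i \<in> Q" if "i < h" for i
    using f(1) g(1) that by (auto simp: w_def bij_betw_def)
  show ?thesis
  proof (rule nested_paths_bound[OF G \<omega>, where v = f and w = w and x = "\<lambda>i. m (f i) (w i)"])
    show "inj_on (\<lambda>i. m (f i) (w i)) {..<h}"
    proof (rule inj_onI)
      fix i j assume ij: "i \<in> {..<h}" "j \<in> {..<h}" "m (f i) (w i) = m (f j) (w j)"
      have "(f i, w i) = (f j, w j)"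
      proof (rule inj_onD)
        show "inj_on (\<lambda>(u, w). m u w) (P \<times> Q)" using K by (simp add: subdivided_biclique_def)
      qed (use ij P Q in auto)
      then show "i = j" using f(1) ij by (auto simp: bij_betw_def inj_on_def)
    qed
  next
    fix i j assume ij: "i < j" "j < h"
    then show "\<omega> (f i) < \<omega> (f j) \<and> \<omega> (f j) < \<omega> (w j) \<and> \<omega> (w j) < \<omega> (w i)"
      using f(2) g(2) less P Q by (simp add: w_def)
  next
    fix i assume "i < h"
    then show "{f i, m (f i) (w i)} \<in> edges G \<and> {w i, m (f i) (w i)} \<in> edges G"
      using K P Q unfolding subdivided_biclique_def by blast
  next
    fix i j assume "i < h" "j < h"
    then have "m (f i) (w i) \<notin> P \<union> Q" using K P Q unfolding subdivided_biclique_def by blast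
    then show "m (f i) (w i) \<noteq> f j \<and> m (f i) (w i) \<noteq> w j" using P Q \<open>j < h\<close> by auto
  qed
qed

lemma halve_by_order:
  fixes \<omega> :: "'a \<Rightarrow> real"
  assumes S: "finite S" "inj_on \<omega> S" and h: "0 < h" "2 * h \<le> card S"
  shows "\<exists>\<tau> S1 S2. S1 \<subseteq> S \<and> S2 \<subseteq> S \<and> card S1 = h \<and> card S2 = h \<and>
    (\<forall>s\<in>S1. \<omega> s < \<tau>) \<and> (\<forall>s\<in>S2. \<tau> \<le> \<omega> s)"
proof -
  obtain f where f: "bij_betw f {..<card S} S" "\<And>i j. i < j \<Longrightarrow> j < card S \<Longrightarrow> \<omega> (f i) < \<omega> (f j)"
    using increasing_enumeration[OF S] by auto
  have sub: "f ` {..<h} \<subseteq> S" "f ` {h..<2 * h} \<subseteq> S"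
    using f(1) h by (auto simp: bij_betw_def)
  have inj: "inj_on f {..<h}" "inj_on f {h..<2 * h}"
    using f(1) h by (auto simp: bij_betw_def intro: inj_on_subset)
  have "\<omega> (f h) \<le> \<omega> (f i)" if "i \<in> {h..<2 * h}" for i
    using f(2)[of h i] that h by (cases "i = h") auto
  moreover have "\<omega> (f i) < \<omega> (f h)" if "i < h" for i using f(2)[of i h] that h by simp
  ultimately show ?thesis
    using sub inj by (intro exI[of _ "\<omega> (f h)"] exI[of _ "f ` {..<h}"] exI[of _ "f ` {h..<2 * h}"])
      (auto simp: card_image)
qed

text \<open>The sides may be mixed in the order. Cut it in the middle of \<open>A\<close>: at least half of \<open>B\<close> lies on one
  side of the cut, and this half forms a separated biclique with the half of \<open>A\<close> on the other side.\<close>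

lemma biclique_bound:
  assumes G: "simple_graph G" and \<omega>: "interleaved_colouring G k \<omega> col"
    and K: "subdivided_biclique G A B m" and card: "card A = 2 * h" "card B = 2 * h"
  shows "h \<le> 2 * k\<^sup>2"
proof (cases "h = 0")
  case False
  have V: "A \<subseteq> verts G" "B \<subseteq> verts G" using K by (auto simp: subdivided_biclique_def)
  then have fin: "finite A" "finite B" using G finite_subset by (auto simp: simple_graph_def)
  have "inj_on \<omega> A" using \<omega> V inj_on_subset by (auto simp: interleaved_colouring_def)
  then obtain \<tau> A1 A2 where A: "A1 \<subseteq> A" "A2 \<subseteq> A" "card A1 = h" "card A2 = h"
    "\<forall>s\<in>A1. \<omega> s < \<tau>" "\<forall>s\<in>A2. \<tau> \<le> \<omega> s"
    using halve_by_order[of A \<omega> h] fin False card by auto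
  have "card B = card {b \<in> B. \<omega> b < \<tau>} + card {b \<in> B. \<tau> \<le> \<omega> b}"
    using fin by (subst card_Un_disjoint[symmetric]) (auto intro!: arg_cong[of _ _ card])
  then consider "h \<le> card {b \<in> B. \<tau> \<le> \<omega> b}" | "h \<le> card {b \<in> B. \<omega> b < \<tau>}" using card by linarith
  then show ?thesis
  proof cases
    case 1
    then obtain Q where Q: "Q \<subseteq> {b \<in> B. \<tau> \<le> \<omega> b}" "card Q = h" by (rule obtain_subset_with_card_n)
    show ?thesis
    proof (rule separated_biclique_bound[OF G \<omega>])
      show "subdivided_biclique G A1 Q m" using subdivided_biclique_subset[OF K] A Q by blast
      show "\<omega> u < \<omega> w" if "u \<in> A1" "w \<in> Q" for u w using that A(5) Q(1) by force
    qed (use A Q in auto)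
  next
    case 2
    then obtain P where P: "P \<subseteq> {b \<in> B. \<omega> b < \<tau>}" "card P = h" by (rule obtain_subset_with_card_n)
    show ?thesis
    proof (rule separated_biclique_bound[OF G \<omega>])
      show "subdivided_biclique G P A2 (\<lambda>u w. m w u)"
        using subdivided_biclique_subset[OF subdivided_biclique_swap[OF K]] A P by blast
      show "\<omega> u < \<omega> w" if "u \<in> P" "w \<in> A2" for u w using that A(6) P(1) by force
    qed (use A P in auto)
  qed
qed simp

section \<open>The lower bound for subdivided complete graphs\<close>

lemma simple_graph_subdivision_complete: "simple_graph (subdivision (complete_graph n))"
proof -
  have "finite {e. e \<subseteq> {..<n} \<and> card e = 2}" by (rule finite_subset[of _ "Pow {..<n}"]) auto
  then show ?thesis
    by (auto simp: simple_graph_def subdivision_def complete_graph_def)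
qed

text \<open>Two halves of the original vertices, one preceding the other, span a separated biclique. With
  \<open>h = n div 2\<close> this gives \<open>n \<le> 2 h + 1 \<le> 4 k\<^sup>2 + 1\<close>, and \<open>1 \<le> k\<^sup>2\<close>.\<close>

lemma convex_antithickness_subdivided_complete:
  "n \<le> 6 * (convex_antithickness (subdivision (complete_graph n)))\<^sup>2"
proof -
  let ?G = "subdivision (complete_graph n)" and ?h = "n div 2"
  let ?k = "convex_antithickness ?G"
  have G: "simple_graph ?G" by (rule simple_graph_subdivision_complete)
  obtain \<omega> col where k: "0 < ?k" and \<omega>: "interleaved_colouring ?G ?k \<omega> col"
    using convex_antithickness_colouring[OF G] by blast
  have "?h \<le> 2 * ?k\<^sup>2"
  proof (cases "?h = 0")
    case False
    let ?O = "Inl ` {..<n} :: (nat + nat set) set"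
    have "inj_on \<omega> ?O"
      using \<omega> by (auto simp: interleaved_colouring_def subdivision_def complete_graph_def intro: inj_on_subset)
    moreover have "card ?O = n" by (simp add: card_image)
    ultimately obtain \<tau> P Q where PQ: "P \<subseteq> ?O" "Q \<subseteq> ?O" "card P = ?h" "card Q = ?h"
      "\<forall>s\<in>P. \<omega> s < \<tau>" "\<forall>s\<in>Q. \<tau> \<le> \<omega> s"
      using halve_by_order[of ?O \<omega> ?h] False by auto
    have disj: "u \<noteq> w" if "u \<in> P" "w \<in> Q" for u w using PQ(5,6) that by force
    have inl: "s = Inl (projl s)" if "s \<in> P \<union> Q" for s using PQ(1,2) that by auto
    define m :: "nat + nat set \<Rightarrow> nat + nat set \<Rightarrow> nat + nat set"
      where "m u w = Inr {projl u, projl w}" for u w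
    have "subdivided_biclique ?G P Q m"
      unfolding subdivided_biclique_def
    proof (intro conjI ballI)
      show "P \<union> Q \<subseteq> verts ?G" using PQ by (auto simp: subdivision_def complete_graph_def)
      show "inj_on (\<lambda>(u, w). m u w) (P \<times> Q)"
      proof (rule inj_onI, clarify)
        fix u w u' w' assume uw: "u \<in> P" "w \<in> Q" "u' \<in> P" "w' \<in> Q" "m u w = m u' w'"
        then have "{projl u, projl w} = {projl u', projl w'}" by (simp add: m_def)
        moreover have "projl u \<noteq> projl w'" "projl u' \<noteq> projl w"
          using disj[of u w'] disj[of u' w] uw inl by (metis UnCI)+
        ultimately have "projl u = projl u'" "projl w = projl w'" by (auto simp: doubleton_eq_iff)
        then show "u = u' \<and> w = w'" using uw inl by (metis UnCI)
      qed
      fix u w assume uw: "u \<in> P" "w \<in> Q"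
      then obtain i j where ij: "u = Inl i" "w = Inl j" "i < n" "j < n" using PQ(1,2) by blast
      moreover have "i \<noteq> j" using disj[OF uw] ij by auto
      ultimately show "{u, m u w} \<in> edges ?G" "{w, m u w} \<in> edges ?G"
        by (auto simp: subdivision_def complete_graph_def m_def intro!: exI[of _ "{i, j}"])
      show "m u w \<notin> P \<union> Q" using PQ(1,2) by (auto simp: m_def)
    qed
    then show ?thesis
      by (rule separated_biclique_bound[OF G \<omega>]) (use PQ in force)+
  qed simp
  moreover have "1 \<le> ?k\<^sup>2" using k by simp
  ultimately show ?thesis by linarith
qed

section \<open>Subdivided complete bipartite graphs have two-thrackle drawings\<close>

lemma thrackle_subset: "thrackle p F \<Longrightarrow> F' \<subseteq> F \<Longrightarrow> thrackle p F'"
  unfolding thrackle_def by blast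

lemma geometric_antithickness_le_2:
  assumes p: "geometric_drawing G p" and F: "thrackle p F\<^sub>1" "thrackle p F\<^sub>2" "edges G \<subseteq> F\<^sub>1 \<union> F\<^sub>2"
  shows "geometric_antithickness G \<le> 2"
proof -
  define col :: "'a set \<Rightarrow> nat" where "col e = (if e \<in> F\<^sub>1 then 0 else 1)" for e
  have "thrackle p {e \<in> edges G. col e = i}" if "i < 2" for i
  proof (cases "i = 0")
    case True
    then have "{e \<in> edges G. col e = i} \<subseteq> F\<^sub>1" by (auto simp: col_def)
    then show ?thesis by (rule thrackle_subset[OF F(1)])
  next
    case False
    then have "{e \<in> edges G. col e = i} \<subseteq> F\<^sub>2" using F(3) by (auto simp: col_def)
    then show ?thesis by (rule thrackle_subset[OF F(2)])
  qed
  moreover have "col ` edges G \<subseteq> {..<2}" by (auto simp: col_def)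
  ultimately have two: "0 < (2::nat) \<and> (\<exists>col :: 'a set \<Rightarrow> nat. col ` edges G \<subseteq> {..<2} \<and>
      (\<forall>i<2. thrackle p {e \<in> edges G. col e = i}))" by auto
  have "drawing_antithickness G p \<le> 2"
    unfolding drawing_antithickness_def by (rule Least_le) (rule two)
  moreover have "0 < drawing_antithickness G p"
    unfolding drawing_antithickness_def
    by (rule LeastI_ex[THEN conjunct1]) (rule exI[of _ 2], rule two)
  then have "geometric_antithickness G \<le> drawing_antithickness G p"
    unfolding geometric_antithickness_def using p by (intro Least_le) blast
  ultimately show ?thesis by simp
qed

text \<open>The drawing puts one side of the biclique on a horizontal line far below a grid, in the order
  opposite to that of the grid columns, and joins each vertex \<open>(a, -L)\<close> to all points \<open>(-a, -b)\<close> of its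
  column. These edges are almost vertical but reverse the horizontal order, so any two with different
  lower ends cross. The signs below make this precise for \<open>L\<close> large compared with the grid size \<open>M\<close>:
  in each orientation the terms with a factor \<open>L\<close> outweigh the rest. Nonzero orientations also
  show that the line of an edge contains no further vertex.\<close>

context
  fixes a b c d M L :: real
  assumes bounds: "1 \<le> a" "a \<le> M" "1 \<le> b" "b \<le> M" "1 \<le> c" "c \<le> M" "1 \<le> d" "d \<le> M"
    and L: "L = 4 * M\<^sup>2"
begin

lemma mult_bounds:
  assumes "1 \<le> x" "x \<le> M" "1 \<le> y" "y \<le> M"
  shows "0 < x * y" "x * y \<le> M\<^sup>2"
  using assms mult_mono[of x M y M] by (auto simp: power2_eq_square)

lemma orient_grid_crossing:
  assumes "1 \<le> \<bar>a - c\<bar>"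
  shows "orient (a, -L) (-a, -b) (c, -L) * orient (a, -L) (-a, -b) (-c, -d) < 0"
proof -
  have sq: "M \<le> M\<^sup>2" "1 \<le> M" using bounds by (auto simp: power2_eq_square)
  have eq1: "orient (a, -L) (-a, -b) (c, -L) = (L - b) * (a - c)"
    by (simp add: orient_def algebra_simps)
  have eq2: "orient (a, -L) (-a, -b) (-c, -d) = L * (c - a) + (2 * (a * d) - b * c - b * a)"
    by (simp add: orient_def algebra_simps)
  have rest: "\<bar>2 * (a * d) - b * c - b * a\<bar> \<le> 2 * M\<^sup>2"
    using mult_bounds[of a d] mult_bounds[of b c] mult_bounds[of b a] bounds by linarith
  have Lb: "0 < L - b" using sq bounds L by linarith
  have LM: "2 * M\<^sup>2 < L" using sq L by linarith
  consider "1 \<le> a - c" | "1 \<le> c - a" using assms by linarith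
  then show ?thesis
  proof cases
    case 1
    then have "L \<le> L * (a - c)" using LM sq by simp
    then have "L * (c - a) + (2 * (a * d) - b * c - b * a) < 0"
    proof -
      have "L * (c - a) = - (L * (a - c))" by (simp add: algebra_simps)
      then show ?thesis using \<open>L \<le> L * (a - c)\<close> rest LM by linarith
    qed
    moreover have "0 < (L - b) * (a - c)" using 1 Lb by simp
    ultimately show ?thesis unfolding eq1 eq2 by (simp add: mult_less_0_iff)
  next
    case 2
    then have "L \<le> L * (c - a)" using LM sq by simp
    then have "0 < L * (c - a) + (2 * (a * d) - b * c - b * a)" using rest LM by linarith
    moreover have "(L - b) * (a - c) < 0" using 2 Lb by (simp add: mult_less_0_iff)
    ultimately show ?thesis
      unfolding eq1 eq2 by (simp add: mult_less_0_iff)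
  qed
qed

lemma orient_grid_same_column:
  assumes "b \<noteq> d"
  shows "orient (a, -L) (-a, -b) (-a, -d) \<noteq> 0"
proof -
  have "orient (a, -L) (-a, -b) (-a, -d) = 2 * a * (d - b)" by (simp add: orient_def algebra_simps)
  then show ?thesis using assms bounds by auto
qed

lemma orient_grid_other_side: "orient (a, -L) (-a, -b) (-L, d) \<noteq> 0"
proof -
  have sq: "M \<le> M\<^sup>2" "1 \<le> M" using bounds by (auto simp: power2_eq_square)
  have "orient (a, -L) (-a, -b) (-L, d) = L * (L - a - b) - 2 * (a * d) - a * b"
    by (simp add: orient_def algebra_simps)
  moreover have "L * 2 \<le> L * (L - a - b)"
    using sq bounds L by (intro mult_left_mono) linarith+
  moreover have "a * d \<le> M\<^sup>2" "a * b \<le> M\<^sup>2"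
    using mult_bounds[of a d] mult_bounds[of a b] bounds by auto
  ultimately show ?thesis using sq L by linarith
qed

end

definition flip :: "point \<Rightarrow> point" where
  "flip z = (snd z, fst z)"

lemma orient_flip: "orient (flip x) (flip y) (flip z) = - orient x y z"
  by (simp add: orient_def flip_def algebra_simps)

text \<open>The three kinds of vertices, encoded as natural numbers.\<close>

definition left :: "nat \<Rightarrow> nat" where
  "left i = to_nat (Inl (Inl i) :: (nat + nat) + nat \<times> nat)"

definition right :: "nat \<Rightarrow> nat" where
  "right j = to_nat (Inl (Inr j) :: (nat + nat) + nat \<times> nat)"

definition mid :: "nat \<Rightarrow> nat \<Rightarrow> nat" where
  "mid i j = to_nat (Inr (i, j) :: (nat + nat) + nat \<times> nat)"

lemma vertex_distinct [simp]:
  "left i = left i' \<longleftrightarrow> i = i'" "right j = right j' \<longleftrightarrow> j = j'"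
  "mid i j = mid i' j' \<longleftrightarrow> i = i' \<and> j = j'"
  "left i \<noteq> right j" "left i \<noteq> mid i' j'" "right j \<noteq> mid i' j'"
  "right j \<noteq> left i" "mid i' j' \<noteq> left i" "mid i' j' \<noteq> right j"
  by (simp_all add: left_def right_def mid_def)

definition biclique_subdivision :: "nat \<Rightarrow> nat graph" where
  "biclique_subdivision m = Graph
     (left ` {..<m} \<union> right ` {..<m} \<union> (\<lambda>(i, j). mid i j) ` ({..<m} \<times> {..<m}))
     ((\<lambda>(i, j). {left i, mid i j}) ` ({..<m} \<times> {..<m}) \<union>
      (\<lambda>(i, j). {right j, mid i j}) ` ({..<m} \<times> {..<m}))"

lemma simple_biclique_subdivision: "simple_graph (biclique_subdivision m)"
  by (auto simp: simple_graph_def biclique_subdivision_def)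

lemma biclique_subdivision_biclique:
  "subdivided_biclique (biclique_subdivision m) (left ` {..<m}) (right ` {..<m})
     (\<lambda>u w. mid (inv left u) (inv right w))"
proof -
  have "inj left" "inj right" by (simp_all add: inj_def)
  then have "inv left (left i) = i" "inv right (right i) = i" for i by simp_all
  then show ?thesis
    by (auto simp: subdivided_biclique_def biclique_subdivision_def inj_on_def)
qed

text \<open>The second side is the mirror image of the first in the diagonal, which maps the grid to itself;
  so the argument for the first side applies to it as well.\<close>

definition place :: "nat \<Rightarrow> nat \<Rightarrow> point" where
  "place m v = (let L = 4 * (real m)\<^sup>2 in
     case from_nat v :: (nat + nat) + nat \<times> nat of
       Inl (Inl i) \<Rightarrow> (real (Suc i), - L)
     | Inl (Inr j) \<Rightarrow> (- L, real (Suc j))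
     | Inr (i, j) \<Rightarrow> (- real (Suc i), - real (Suc j)))"

lemma place_vertex:
  "place m (left i) = (real (Suc i), - (4 * (real m)\<^sup>2))"
  "place m (right j) = flip (real (Suc j), - (4 * (real m)\<^sup>2))"
  "place m (mid i j) = (- real (Suc i), - real (Suc j))"
  by (simp_all add: place_def left_def right_def mid_def flip_def)

lemma flip_place:
  "flip (place m (left i)) = place m (right i)" "flip (place m (mid i j)) = place m (mid j i)"
  "flip (place m (right i)) = place m (left i)"
  by (simp_all add: place_vertex flip_def)

lemma orient_left:
  assumes ij: "i < m" "j < m" and v: "v \<in> verts (biclique_subdivision m) - {left i, mid i j}"
  shows "orient (place m (left i)) (place m (mid i j)) (place m v) \<noteq> 0"
proof -
  have b: "1 \<le> real (Suc i)" "real (Suc i) \<le> real m" if "i < m" for i using that by auto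
  note b' = b[OF ij(1)] b[OF ij(2)]
  have far: "1 \<le> \<bar>real (Suc i) - real (Suc k)\<bar>" if "k \<noteq> i" for k using that by linarith
  from v consider k where "v = left k" "k < m" "k \<noteq> i" | k where "v = right k" "k < m"
    | k l where "v = mid k l" "k < m" "l < m" "k \<noteq> i" | l where "v = mid i l" "l < m" "l \<noteq> j"
    by (auto simp: biclique_subdivision_def) blast
  then show ?thesis
  proof cases
    case 1
    then show ?thesis
      using orient_grid_crossing[OF b' b[OF 1(2)] b[OF 1(2)] refl far[OF 1(3)]]
      by (auto simp: place_vertex)
  next
    case 2
    then show ?thesis
      using orient_grid_other_side[OF b' b[OF 2(2)] b[OF 2(2)] refl]
      by (auto simp: place_vertex flip_def)
  next
    case 3
    then show ?thesis
      using orient_grid_crossing[OF b' b[OF 3(2)] b[OF 3(3)] refl far[OF 3(4)]]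
      by (auto simp: place_vertex)
  next
    case 4
    then show ?thesis
      using orient_grid_same_column[OF b' b[OF 4(2)] b[OF 4(2)] refl]
      by (auto simp: place_vertex)
  qed
qed

lemma orient_right:
  assumes ij: "i < m" "j < m" and v: "v \<in> verts (biclique_subdivision m) - {right j, mid i j}"
  shows "orient (place m (right j)) (place m (mid i j)) (place m v) \<noteq> 0"
proof -
  obtain v' where "place m v' = flip (place m v)"
    "v' \<in> verts (biclique_subdivision m) - {left j, mid j i}"
  proof -
    from v consider k where "v = left k" "k < m" | k where "v = right k" "k < m" "k \<noteq> j"
      | k l where "v = mid k l" "k < m" "l < m" "(k, l) \<noteq> (i, j)"
      by (auto simp: biclique_subdivision_def)
    then show ?thesis
    proof cases
      case 1 then show ?thesis
        using that[of "right k"] by (auto simp: flip_place biclique_subdivision_def)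
    next
      case 2 then show ?thesis
        using that[of "left k"] by (auto simp: flip_place biclique_subdivision_def)
    next
      case 3 then show ?thesis
        using that[of "mid l k"] by (auto simp: flip_place biclique_subdivision_def)
    qed
  qed
  then have "orient (flip (place m (right j))) (flip (place m (mid i j))) (flip (place m v)) \<noteq> 0"
    using orient_left[OF ij(2,1), of v'] by (simp add: flip_place)
  then show ?thesis by (simp add: orient_flip)
qed

lemma inj_place: "inj_on (place m) (verts (biclique_subdivision m))"
proof (cases "m = 0")
  case False
  then have "0 < 4 * (real m)\<^sup>2" by simp
  then have "1 + real k \<noteq> - (4 * (real m)\<^sup>2)" "- (4 * (real m)\<^sup>2) \<noteq> 1 + real k" for k
    by linarith+
  then show ?thesis
    by (auto simp: inj_on_def biclique_subdivision_def place_vertex flip_def)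
qed (simp add: biclique_subdivision_def)

lemma geometric_drawing_place: "geometric_drawing (biclique_subdivision m) (place m)"
proof (rule geometric_drawingI[OF simple_biclique_subdivision inj_place])
  fix e assume "e \<in> edges (biclique_subdivision m)"
  then consider i j where "e = {left i, mid i j}" "i < m" "j < m"
    | i j where "e = {right j, mid i j}" "i < m" "j < m"
    by (auto simp: biclique_subdivision_def)
  then show "\<exists>a b. e = {a, b} \<and>
      (\<forall>v\<in>verts (biclique_subdivision m) - e. orient (place m a) (place m b) (place m v) \<noteq> 0)"
  proof cases
    case (1 i j)
    then show ?thesis
      using orient_left[of i m j] by (intro exI[of _ "left i"] exI[of _ "mid i j"]) simp
  next
    case (2 i j)
    then show ?thesis
      using orient_right[of i m j] by (intro exI[of _ "right j"] exI[of _ "mid i j"]) simp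
  qed
qed

lemma left_edges_meet:
  assumes ij: "i < m" "j < m" and kl: "k < m" "l < m" and "i \<noteq> k"
  shows "closed_segment (place m (left i)) (place m (mid i j)) \<inter>
    closed_segment (place m (left k)) (place m (mid k l)) \<noteq> {}"
proof -
  have b: "1 \<le> real (Suc i)" "real (Suc i) \<le> real m" if "i < m" for i using that by auto
  have far: "1 \<le> \<bar>real (Suc i) - real (Suc k)\<bar>" "1 \<le> \<bar>real (Suc k) - real (Suc i)\<bar>"
    using assms(5) by linarith+
  show ?thesis
    unfolding place_vertex
    using orient_grid_crossing[OF b[OF ij(1)] b[OF ij(2)] b[OF kl(1)] b[OF kl(2)] refl far(1)]
      orient_grid_crossing[OF b[OF kl(1)] b[OF kl(2)] b[OF ij(1)] b[OF ij(2)] refl far(2)]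
    by (intro segments_cross)
qed

lemma flip_closed_segment: "flip ` closed_segment x y = closed_segment (flip x) (flip y)"
  by (rule closed_segment_linear_image[symmetric]) (auto simp: flip_def intro!: linearI)

lemma geometric_antithickness_biclique_subdivision:
  "geometric_antithickness (biclique_subdivision m) \<le> 2"
proof (rule geometric_antithickness_le_2[OF geometric_drawing_place])
  let ?I = "{..<m} \<times> {..<m}"
  let ?F1 = "(\<lambda>(i, j). {left i, mid i j}) ` ?I" and ?F2 = "(\<lambda>(i, j). {right j, mid i j}) ` ?I"
  show "edges (biclique_subdivision m) \<subseteq> ?F1 \<union> ?F2" by (simp add: biclique_subdivision_def)
  show "thrackle (place m) ?F1"
  proof (rule thrackleI[OF simple_biclique_subdivision geometric_drawing_place])
    show "?F1 \<subseteq> edges (biclique_subdivision m)" by (simp add: biclique_subdivision_def)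
    fix e f assume "e \<in> ?F1" "f \<in> ?F1" "e \<inter> f = {}"
    then obtain i j k l where e: "e = {left i, mid i j}" and f: "f = {left k, mid k l}"
      and ijkl: "i < m" "j < m" "k < m" "l < m" and "i \<noteq> k"
      by auto
    then show "edge_segment (place m) e \<inter> edge_segment (place m) f \<noteq> {}"
      unfolding e f edge_segment_pair by (intro left_edges_meet)
  qed
  show "thrackle (place m) ?F2"
  proof (rule thrackleI[OF simple_biclique_subdivision geometric_drawing_place])
    show "?F2 \<subseteq> edges (biclique_subdivision m)" by (simp add: biclique_subdivision_def)
    fix e f assume ef: "e \<in> ?F2" "f \<in> ?F2" "e \<inter> f = {}"
    then obtain i j k l where e: "e = {right j, mid i j}" and f: "f = {right l, mid k l}"
      and ijkl: "i < m" "j < m" "k < m" "l < m" and "j \<noteq> l"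
      by auto
    have "flip ` (closed_segment (place m (left j)) (place m (mid j i)) \<inter>
        closed_segment (place m (left l)) (place m (mid l k))) \<noteq> {}"
      using left_edges_meet[of j m i l k] ijkl \<open>j \<noteq> l\<close> by blast
    then have "flip ` closed_segment (place m (left j)) (place m (mid j i)) \<inter>
        flip ` closed_segment (place m (left l)) (place m (mid l k)) \<noteq> {}" by blast
    then show "edge_segment (place m) e \<inter> edge_segment (place m) f \<noteq> {}"
      by (simp add: e f edge_segment_pair flip_closed_segment flip_place)
  qed
qed

section \<open>Separation of the two parameters\<close>

lemma convex_antithickness_biclique_subdivision:
  "h \<le> 2 * (convex_antithickness (biclique_subdivision (2 * h)))\<^sup>2"
proof -
  let ?G = "biclique_subdivision (2 * h)"
  obtain \<omega> col where \<omega>: "interleaved_colouring ?G (convex_antithickness ?G) \<omega> col"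
    using convex_antithickness_colouring[OF simple_biclique_subdivision] by blast
  have "inj left" "inj right" by (simp_all add: inj_def)
  then have "card (left ` {..<2 * h}) = 2 * h" "card (right ` {..<2 * h}) = 2 * h"
    by (simp_all add: card_image inj_on_subset)
  then show ?thesis
    by (rule biclique_bound[OF simple_biclique_subdivision \<omega> biclique_subdivision_biclique])
qed

lemma convex_antithickness_biclique_subdivision_unbounded:
  "\<not> bdd_above (range (\<lambda>m. convex_antithickness (biclique_subdivision m)))"
proof
  assume "bdd_above (range (\<lambda>m. convex_antithickness (biclique_subdivision m)))"
  then obtain K where K: "convex_antithickness (biclique_subdivision m) \<le> K" for m
    by (auto simp: bdd_above_def)
  define h where "h = Suc (2 * K\<^sup>2)"
  have "(convex_antithickness (biclique_subdivision (2 * h)))\<^sup>2 \<le> K\<^sup>2"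
    using K by (intro power_mono) auto
  then have "h \<le> 2 * K\<^sup>2" using convex_antithickness_biclique_subdivision[of h] by linarith
  then show False by (simp add: h_def)
qed

theorem mainTheorem4:
  "(\<forall>n::nat. sqrt (real n / 6) \<le> real (convex_antithickness (subdivision (complete_graph n)))) \<and>
   \<not> bdd_above (range (\<lambda>n::nat. sqrt (real n / 6))) \<and>
   \<not> (\<exists>g :: nat \<Rightarrow> nat. \<forall>G :: nat graph. simple_graph G \<longrightarrow>
        convex_antithickness G \<le> g (geometric_antithickness G)) \<and>
   separated (convex_antithickness :: nat graph \<Rightarrow> nat) geometric_antithickness"
proof (intro conjI allI notI)
  fix n
  let ?k = "convex_antithickness (subdivision (complete_graph n))"
  have "real n \<le> real (6 * ?k\<^sup>2)"
    using convex_antithickness_subdivided_complete[of n] by (simp only: of_nat_le_iff)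
  then have "real n / 6 \<le> (real ?k)\<^sup>2" by simp
  then show "sqrt (real n / 6) \<le> real ?k" by (intro real_le_lsqrt) auto
next
  assume "bdd_above (range (\<lambda>n::nat. sqrt (real n / 6)))"
  then obtain B where B: "sqrt (real n / 6) \<le> B" for n by (auto simp: bdd_above_def)
  obtain n :: nat where "6 * B\<^sup>2 < real n" using reals_Archimedean2 by blast
  then have "B\<^sup>2 < real n / 6" by simp
  then have "B < sqrt (real n / 6)" by (rule real_less_rsqrt)
  then show False using B[of n] by simp
next
  assume "\<exists>g :: nat \<Rightarrow> nat. \<forall>G :: nat graph. simple_graph G \<longrightarrow>
      convex_antithickness G \<le> g (geometric_antithickness G)"
  then obtain g :: "nat \<Rightarrow> nat" where
    g: "\<And>G :: nat graph. simple_graph G \<Longrightarrow> convex_antithickness G \<le> g (geometric_antithickness G)"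
    by blast
  have "convex_antithickness (biclique_subdivision m) \<le> Max (g ` {..2})" for m
  proof (rule order_trans[OF g[OF simple_biclique_subdivision]])
    show "g (geometric_antithickness (biclique_subdivision m)) \<le> Max (g ` {..2})"
      using geometric_antithickness_biclique_subdivision by (intro Max_ge) auto
  qed
  then show False
    using convex_antithickness_biclique_subdivision_unbounded by (auto simp: bdd_above_def)
next
  have "bdd_above (geometric_antithickness ` range biclique_subdivision)"
    using geometric_antithickness_biclique_subdivision by (auto simp: bdd_above_def)
  moreover have "\<not> bdd_above (convex_antithickness ` range biclique_subdivision)"
    using convex_antithickness_biclique_subdivision_unbounded by (simp add: image_image)
  ultimately show "separated (convex_antithickness :: nat graph \<Rightarrow> nat) geometric_antithickness"
    unfolding separated_def using simple_biclique_subdivision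
    by (intro exI[of _ "range biclique_subdivision"]) auto
qed

end
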